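(* Suppose $C \in M_n$ is non-scalar and $\mathcal{F} \subseteq M_n$ is non-empty. The following conditions hold. (a) The set $W_C(\mathcal{F}) = \{\mu\}$ if and only if $\mathcal{F} = \{\nu I : \nu\,\mathrm{tr}\,C = \mu\}$. (b) The set $W_C(\mathcal{F})$ is a subset of a straight line $L$ if and only if (i) $\mathcal{F} \subseteq \{\nu I : \nu \in \mathbb{C},\ \nu\,\mathrm{tr}\,C \in L\}$, or (ii) there are complex units $\alpha, \gamma \in \mathbb{C}$ such that $\gamma(C - (\mathrm{tr}\,C) I/n)$ and $\alpha(A - (\mathrm{tr}\,A) I/n)$ are Hermitian for all $A \in \mathcal{F}$, and $\{(\mathrm{tr}\,C)(\mathrm{tr}\,A)/n : A \in \mathcal{F}\}$ is collinear. (c) The set $W_C(\mathcal{F})$ is a convex polygon if and only if $W_C(\mathcal{F}) = \mathrm{conv}\{v_1,\dots,v_m\}$ where each $v_j$ is of the form $(c_1,\dots,c_n)(a_1,\dots,a_n)^t$. Here $c_1,\dots,c_n$ are eigenvalues of $C$, and $a_1,\dots,a_n$ are eigenvalues of some $A_j \in \mathcal{F}$.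
   Context: $M_n$ is the set of $n\times n$ complex matrices, $I$ is the identity matrix, and $\mathrm{tr}$ is the trace. For $C, A \in M_n$, the $C$-numerical range of $A$ is $W_C(A) = \{\mathrm{tr}(CU^*AU) : U \in M_n \text{ unitary}\} \subseteq \mathbb{C}$. For a non-empty $\mathcal{F}\subseteq M_n$, $W_C(\mathcal{F}) = \bigcup\{W_C(A) : A \in \mathcal{F}\}$. A complex unit is a complex number of modulus 1. $\mathrm{conv}$ denotes the convex hull, and $\mathbb{C}$ is identified with $\mathbb{R}^2$, so straight lines, collinearity and convex polygons are understood in the real plane.
   Formalization: In (a), the equality F = {νI : ν tr C = μ} is replaced by the inclusion ⊆ (equality fails when tr C = 0); in (b)(ii), "collinear" is replaced by: the points (tr C)(tr A)/n lie on L and L has the direction of conj(αγ), since mere collinearity does not suffice. *)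

theory Defs
  imports "HOL-Analysis.Polytope" "Jordan_Normal_Form.Schur_Decomposition"
begin

definition mat_trace :: "complex mat \<Rightarrow> complex" where
  "mat_trace A = (\<Sum>i<dim_row A. A $$ (i, i))"

definition hermitian_mat :: "complex mat \<Rightarrow> bool" where
  "hermitian_mat A \<longleftrightarrow> mat_adjoint A = A"

definition unitary_mats :: "nat \<Rightarrow> complex mat set" where
  "unitary_mats n = {U \<in> carrier_mat n n. mat_adjoint U * U = 1\<^sub>m n \<and> U * mat_adjoint U = 1\<^sub>m n}"

definition scalar_mat :: "complex mat \<Rightarrow> bool" where
  "scalar_mat A \<longleftrightarrow> (\<exists>\<nu>. A = \<nu> \<cdot>\<^sub>m 1\<^sub>m (dim_row A))"

definition C_numrange :: "complex mat \<Rightarrow> complex mat \<Rightarrow> complex set" where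
  "C_numrange C A = {mat_trace (C * mat_adjoint U * A * U) | U. U \<in> unitary_mats (dim_row A)}"

definition C_numrange_family :: "complex mat \<Rightarrow> complex mat set \<Rightarrow> complex set" where
  "C_numrange_family C \<F> = (\<Union>A\<in>\<F>. C_numrange C A)"

definition trace_free_part :: "complex mat \<Rightarrow> complex mat" where
  "trace_free_part A = A - (mat_trace A / of_nat (dim_row A)) \<cdot>\<^sub>m 1\<^sub>m (dim_row A)"

(* In the collinearity condition of part (b), collinearity of the points tr C tr A / n alone is
   not enough: for C = diag(1,0) and F = {C, C + iI} these are the two points 1/2 and 1/2 + i,
   while 0, 1 and i all lie in the C-numerical range of F. The points have to lie on L and L has
   to have the direction of cnj (alpha gamma), since each set C_numrange C A is contained in
   tr C tr A / n + cnj (alpha gamma) * (reals). Similarly, the condition on the family in part (a)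
   is an inclusion: if tr C = 0, every non-empty family of scalar matrices has C-numerical
   range {0}. *)
definition straight_line :: "complex set \<Rightarrow> bool" where
  "straight_line L \<longleftrightarrow> affine L \<and> aff_dim L = 1"

(* The list contains all eigenvalues with algebraic multiplicity, in an arbitrary order;
   comparing degrees, its length is the dimension of A. *)
definition eigenvalue_list :: "complex mat \<Rightarrow> complex list \<Rightarrow> bool" where
  "eigenvalue_list A es \<longleftrightarrow> char_poly A = (\<Prod>e\<leftarrow>es. [:- e, 1:])"

(* Points and segments count as (degenerate) convex polygons. *)
definition convex_polygon :: "complex set \<Rightarrow> bool" where
  "convex_polygon P \<longleftrightarrow> polytope P \<and> P \<noteq> {}"

end

theory Submission
  imports Defs "HOL-Real_Asymp.Real_Asymp"
begin

text \<open>An alternating sum over diagonal sign matrices isolates the products \<open>c\<^sub>0\<^sub>1 a\<^sub>1\<^sub>0\<close> and \<open>c\<^sub>1\<^sub>0 a\<^sub>0\<^sub>1\<close> of entries of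
  unitary conjugates of \<open>C\<close> and \<open>A\<close>, and the two conjugations can be chosen independently. If
  \<open>W\<^sub>C(A)\<close> is a point, these products vanish; if it lies on a line of direction \<open>d\<close>, then
  \<open>c\<^sub>0\<^sub>1 a\<^sub>1\<^sub>0 = d\<^sup>2 cnj (c\<^sub>1\<^sub>0 a\<^sub>0\<^sub>1)\<close>, so \<open>C - \<kappa> C\<^sup>*\<close> and \<open>A - \<kappa>' A\<^sup>*\<close> have no off-diagonal entries in any
  orthonormal basis and hence are scalar. For a polygon, a vertex \<open>tr (C A)\<close> is a corner, so every
  smooth curve through it inside the polygon has zero velocity there. For the curves obtained from
  the unitaries \<open>I + (w - 1) x x\<^sup>* / (x\<^sup>* x)\<close> this says \<open>x\<^sup>* (C A - A C) x = 0\<close>; hence \<open>C\<close> and \<open>A\<close>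
  commute, are simultaneously triangularizable, and \<open>tr (C A)\<close> is a sum of products of
  eigenvalues.\<close>

section \<open>Traces and unitary conjugation\<close>

lemma mat_adjoint_carrier [simp]:
  "A \<in> carrier_mat m n \<Longrightarrow> mat_adjoint A \<in> carrier_mat n m"
  by (auto simp: mat_adjoint_def mat_of_rows_def)

lemma mat_adjoint_dim [simp]:
  "dim_row (mat_adjoint A) = dim_col A" "dim_col (mat_adjoint A) = dim_row A"
  by (auto simp: mat_adjoint_def mat_of_rows_def)

lemma mat_adjoint_index [simp]:
  fixes A :: "complex mat"
  shows "i < dim_col A \<Longrightarrow> j < dim_row A \<Longrightarrow> mat_adjoint A $$ (i, j) = cnj (A $$ (j, i))"
  by (auto simp: mat_adjoint_def mat_of_rows_def)

lemma index_mult_mat_sum: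
  "A \<in> carrier_mat n k \<Longrightarrow> B \<in> carrier_mat k m \<Longrightarrow> i < n \<Longrightarrow> j < m \<Longrightarrow>
    (A * B) $$ (i, j) = (\<Sum>l<k. A $$ (i, l) * B $$ (l, j))"
  by (simp add: scalar_prod_def atLeast0LessThan)

lemma mat_adjoint_mult:
  fixes A B :: "complex mat"
  assumes "A \<in> carrier_mat n k" "B \<in> carrier_mat k m"
  shows "mat_adjoint (A * B) = mat_adjoint B * mat_adjoint A"
  using assms by (intro eq_matI) (auto simp: scalar_prod_def mult.commute)

lemma mat_adjoint_adjoint [simp]: "mat_adjoint (mat_adjoint A) = (A :: complex mat)"
  by (intro eq_matI) auto

lemma mat_trace_mult:
  assumes "A \<in> carrier_mat n m" "B \<in> carrier_mat m n"
  shows "mat_trace (A * B) = (\<Sum>i<n. \<Sum>j<m. A $$ (i, j) * B $$ (j, i))"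
  using assms by (auto simp: mat_trace_def scalar_prod_def atLeast0LessThan intro!: sum.cong)

lemma mat_trace_comm:
  assumes "A \<in> carrier_mat n m" "B \<in> carrier_mat m n"
  shows "mat_trace (A * B) = mat_trace (B * A)"
  unfolding mat_trace_mult[OF assms] mat_trace_mult[OF assms(2,1)]
  by (subst sum.swap) (simp add: mult.commute)

lemma unitary_matsI:
  assumes "U \<in> carrier_mat n n" "mat_adjoint U * U = 1\<^sub>m n"
  shows "U \<in> unitary_mats n"
  using assms mat_mult_left_right_inverse[of "mat_adjoint U" n U] by (auto simp: unitary_mats_def)

lemma unitary_matsD:
  assumes "U \<in> unitary_mats n"
  shows "U \<in> carrier_mat n n" "mat_adjoint U * U = 1\<^sub>m n" "U * mat_adjoint U = 1\<^sub>m n"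
  using assms by (auto simp: unitary_mats_def)

lemma unitary_one: "1\<^sub>m n \<in> unitary_mats n"
proof -
  have "mat_adjoint (1\<^sub>m n) = (1\<^sub>m n :: complex mat)" by (intro eq_matI) auto
  then show ?thesis by (intro unitary_matsI) auto
qed

lemma unitary_adjoint: "U \<in> unitary_mats n \<Longrightarrow> mat_adjoint U \<in> unitary_mats n"
  by (auto simp: unitary_mats_def)

lemma unitary_mult:
  assumes U: "U \<in> unitary_mats n" and V: "V \<in> unitary_mats n"
  shows "U * V \<in> unitary_mats n"
proof (rule unitary_matsI)
  note [simp] = unitary_matsD[OF U] unitary_matsD[OF V]
  note [simp] = mult_carrier_mat[of _ n n _ n]
  show "U * V \<in> carrier_mat n n" by simp
  have "mat_adjoint (U * V) * (U * V) = (mat_adjoint V * mat_adjoint U) * (U * V)"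
    by (simp add: mat_adjoint_mult[of U n n V n])
  also have "\<dots> = mat_adjoint V * (mat_adjoint U * (U * V))"
    by (rule assoc_mult_mat[of _ n n _ n _ n]) auto
  also have "mat_adjoint U * (U * V) = (mat_adjoint U * U) * V"
    by (rule assoc_mult_mat[of _ n n _ n _ n, symmetric]) auto
  finally show "mat_adjoint (U * V) * (U * V) = 1\<^sub>m n" by (simp add: left_mult_one_mat[of _ n n])
qed

definition conj_mat :: "complex mat \<Rightarrow> complex mat \<Rightarrow> complex mat" where
  "conj_mat V A = mat_adjoint V * A * V"

lemma conj_mat_carrier [simp]:
  "V \<in> unitary_mats n \<Longrightarrow> A \<in> carrier_mat n n \<Longrightarrow> conj_mat V A \<in> carrier_mat n n"
  by (auto simp: conj_mat_def unitary_mats_def)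

lemma conj_mat_conj_mat:
  assumes "U \<in> unitary_mats n" "V \<in> unitary_mats n" "A \<in> carrier_mat n n"
  shows "conj_mat U (conj_mat V A) = conj_mat (V * U) A"
proof -
  note [simp] = unitary_matsD(1)[OF assms(1)] unitary_matsD(1)[OF assms(2)] assms(3)
  note a = assoc_mult_mat[of _ n n _ n _ n] mult_carrier_mat[of _ n n _ n]
  show ?thesis
    by (simp add: conj_mat_def mat_adjoint_mult[of V n n U n] a)
qed

lemma conj_mat_index:
  assumes "V \<in> carrier_mat n n" "A \<in> carrier_mat n n" "i < n" "j < n"
  shows "conj_mat V A $$ (i, j) = (\<Sum>k<n. \<Sum>l<n. cnj (V $$ (k, i)) * A $$ (k, l) * V $$ (l, j))"
proof -
  have "conj_mat V A $$ (i, j) = (\<Sum>l<n. (\<Sum>k<n. cnj (V $$ (k, i)) * A $$ (k, l)) * V $$ (l, j))"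
    unfolding conj_mat_def using assms
    by (subst index_mult_mat_sum[of _ n n _ n])
      (auto simp: scalar_prod_def atLeast0LessThan mult_carrier_mat[of _ n n _ n] intro!: sum.cong)
  also have "\<dots> = (\<Sum>k<n. \<Sum>l<n. cnj (V $$ (k, i)) * A $$ (k, l) * V $$ (l, j))"
    by (subst sum.swap) (simp add: sum_distrib_right)
  finally show ?thesis .
qed

lemma C_numrange_iff:
  assumes "A \<in> carrier_mat n n" "C \<in> carrier_mat n n"
  shows "z \<in> C_numrange C A \<longleftrightarrow> (\<exists>U\<in>unitary_mats n. z = mat_trace (C * conj_mat U A))"
proof -
  have eq: "C * mat_adjoint U * A * U = C * conj_mat U A" if "U \<in> unitary_mats n" for U
    using assms unitary_matsD(1)[OF that] unfolding conj_mat_def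
    by (simp add: assoc_mult_mat[of _ n n _ n _ n] mult_carrier_mat[of _ n n _ n])
  have "z \<in> C_numrange C A \<longleftrightarrow> (\<exists>U\<in>unitary_mats n. z = mat_trace (C * mat_adjoint U * A * U))"
    using assms by (auto simp: C_numrange_def)
  then show ?thesis by (simp add: eq cong: bex_cong)
qed

text \<open>By cyclicity of the trace, the conjugation of \<open>C\<close> by \<open>U\<close> moves
  over to \<open>A\<close> as a conjugation by the adjoint of \<open>U\<close>. Hence orthonormal
  bases adapted to \<open>C\<close> and to \<open>A\<close> may be chosen independently.\<close>

lemma C_numrange_conj:
  assumes C: "C \<in> carrier_mat n n" and A: "A \<in> carrier_mat n n"
    and U: "U \<in> unitary_mats n" and V: "V \<in> unitary_mats n"
  shows "mat_trace (conj_mat U C * conj_mat V A) \<in> C_numrange C A"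
proof -
  let ?B = "conj_mat V A"
  note [simp] = unitary_matsD(1)[OF U] unitary_matsD(1)[OF V]
  note a = assoc_mult_mat[of _ n n _ n _ n] mult_carrier_mat[of _ n n _ n]
  have B: "?B \<in> carrier_mat n n" using A V by simp
  have "conj_mat U C * ?B = mat_adjoint U * (C * (U * ?B))"
    unfolding conj_mat_def using C A by (simp add: a)
  then have "mat_trace (conj_mat U C * ?B) = mat_trace ((C * (U * ?B)) * mat_adjoint U)"
    using C B by (simp add: mat_trace_comm[of "mat_adjoint U" n n] mult_carrier_mat[of _ n n _ n])
  also have "(C * (U * ?B)) * mat_adjoint U = C * conj_mat (mat_adjoint U) ?B"
    using C B by (simp add: conj_mat_def a)
  also have "conj_mat (mat_adjoint U) ?B = conj_mat (V * mat_adjoint U) A"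
    using A U V by (intro conj_mat_conj_mat) (auto intro: unitary_adjoint)
  finally show ?thesis
    using A C U V by (auto simp: C_numrange_iff intro: unitary_mult unitary_adjoint)
qed

section \<open>Off-diagonal entries of unitary conjugates\<close>

lemma adjoint_mult_self_index:
  fixes U :: "complex mat"
  assumes "U \<in> carrier_mat n n" "i < n" "j < n"
  shows "(mat_adjoint U * U) $$ (i, j) = (\<Sum>l<n. cnj (U $$ (l, i)) * U $$ (l, j))"
  using assms by (auto simp: scalar_prod_def atLeast0LessThan intro!: sum.cong)

text \<open>Used to move any pair of distinct indices to the position (0, 1), so that a condition
  imposed there in all orthonormal bases controls every off-diagonal entry.\<close>

lemma perm_unitary:
  assumes "p permutes {..<n}"
  defines "P \<equiv> Matrix.mat n n (\<lambda>(i, j). if i = p j then 1 else 0 :: complex)"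
  shows "P \<in> unitary_mats n"
    and "\<And>M i j. M \<in> carrier_mat n n \<Longrightarrow> i < n \<Longrightarrow> j < n \<Longrightarrow> conj_mat P M $$ (i, j) = M $$ (p i, p j)"
proof -
  have P [simp]: "P \<in> carrier_mat n n" by (simp add: P_def)
  have pn: "p i < n" if "i < n" for i using permutes_in_image[OF assms(1), of i] that by simp
  have inj: "p i = p j \<longleftrightarrow> i = j" for i j using permutes_inj[OF assms(1)] by (auto dest: injD)
  have idx: "P $$ (i, j) = (if i = p j then 1 else 0)" if "i < n" "j < n" for i j
    using that by (simp add: P_def)
  have "mat_adjoint P * P = 1\<^sub>m n"
  proof (rule eq_matI)
    fix i j assume ij: "i < dim_row (1\<^sub>m n :: complex mat)" "j < dim_col (1\<^sub>m n :: complex mat)"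
    then have "(mat_adjoint P * P) $$ (i, j) = (\<Sum>l<n. cnj (P $$ (l, i)) * P $$ (l, j))"
      using P by (simp add: adjoint_mult_self_index[of _ n])
    also have "\<dots> = (\<Sum>l<n. if l = p i then (if i = j then 1 else 0) else 0)"
      using ij inj by (intro sum.cong) (auto simp: idx)
    also have "\<dots> = 1\<^sub>m n $$ (i, j)" using ij pn by simp
    finally show "(mat_adjoint P * P) $$ (i, j) = 1\<^sub>m n $$ (i, j)" .
  qed (simp_all add: carrier_matD[OF P])
  then show "P \<in> unitary_mats n" by (intro unitary_matsI) auto
  fix M :: "complex mat" and i j assume M: "M \<in> carrier_mat n n" and ij: "i < n" "j < n"
  have "conj_mat P M $$ (i, j) = (\<Sum>k<n. \<Sum>l<n. cnj (P $$ (k, i)) * M $$ (k, l) * P $$ (l, j))"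
    using M ij by (intro conj_mat_index) auto
  also have "\<dots> = (\<Sum>k<n. \<Sum>l<n. if k = p i then (if l = p j then M $$ (p i, p j) else 0) else 0)"
    using ij by (intro sum.cong refl) (auto simp: idx)
  also have "\<dots> = (\<Sum>k<n. if k = p i then (\<Sum>l<n. if l = p j then M $$ (p i, p j) else 0) else 0)"
    by (intro sum.cong refl) auto
  also have "\<dots> = M $$ (p i, p j)" using ij pn by simp
  finally show "conj_mat P M $$ (i, j) = M $$ (p i, p j)" .
qed

definition sqnorm :: "nat \<Rightarrow> (nat \<Rightarrow> complex) \<Rightarrow> complex" where
  "sqnorm n x = (\<Sum>k<n. cnj (x k) * x k)"

text \<open>The complex reflection that multiplies the vector \<open>x\<close> by \<open>w\<close>
  and fixes its orthogonal complement. Dividing by \<open>sqnorm n x\<close> avoids normalizing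
  \<open>x\<close>.\<close>

definition rank_one_unitary :: "nat \<Rightarrow> (nat \<Rightarrow> complex) \<Rightarrow> complex \<Rightarrow> complex mat" where
  "rank_one_unitary n x w = Matrix.mat n n (\<lambda>(i, j).
     (if i = j then 1 else 0) + (w - 1) / sqnorm n x * x i * cnj (x j))"

lemma cnj_sqnorm [simp]: "cnj (sqnorm n x) = sqnorm n x"
  by (simp add: sqnorm_def mult.commute)

lemma rank_one_unitary:
  assumes "cmod w = 1" "sqnorm n x \<noteq> 0"
  shows "rank_one_unitary n x w \<in> unitary_mats n"
proof (rule unitary_matsI)
  let ?U = "rank_one_unitary n x w"
  define N where "N = sqnorm n x"
  define s where "s = (w - 1) / N"
  have N0: "N \<noteq> 0" and cN: "cnj N = N" using assms by (auto simp: N_def)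
  have w: "w * cnj w = 1" using assms(1) by (simp add: complex_norm_square[symmetric])
  show U: "?U \<in> carrier_mat n n" by (simp add: rank_one_unitary_def)
  \<comment> \<open>Since \<open>w = 1 + s * N\<close>, this is the equation
    \<open>w * cnj w = 1\<close> with 1 subtracted and \<open>N\<close> divided out.\<close>
  have s: "s + cnj s + s * cnj s * N = 0"
    using N0 w by (simp add: s_def cN field_simps)
  show "mat_adjoint ?U * ?U = 1\<^sub>m n"
  proof (rule eq_matI)
    fix i j assume ij: "i < dim_row (1\<^sub>m n :: complex mat)" "j < dim_col (1\<^sub>m n :: complex mat)"
    then have "(mat_adjoint ?U * ?U) $$ (i, j) = (\<Sum>l<n. cnj (?U $$ (l, i)) * ?U $$ (l, j))"
      by (simp add: adjoint_mult_self_index[OF U])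
    also have "\<dots> = (\<Sum>l<n. (if l = i then (if i = j then 1 else 0) else 0)
        + (if l = i then s * x i * cnj (x j) else 0) + (if l = j then cnj s * x i * cnj (x j) else 0)
        + s * cnj s * x i * cnj (x j) * (cnj (x l) * x l))"
      using ij by (intro sum.cong) (auto simp: rank_one_unitary_def s_def N_def algebra_simps)
    also have "\<dots> = (if i = j then 1 else 0) + (s + cnj s + s * cnj s * N) * (x i * cnj (x j))"
      using ij unfolding sum.distrib sum_distrib_left[symmetric] N_def sqnorm_def
      by (simp add: algebra_simps)
    finally show "(mat_adjoint ?U * ?U) $$ (i, j) = 1\<^sub>m n $$ (i, j)" using ij by (simp add: s)
  qed (use U in auto)
qed

text \<open>Permuting basis vectors shows that \<open>M\<close> is diagonal, and the same holds for
  each of its unitary conjugates. A rotation that mixes two basis vectors then forces the two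
  diagonal entries to agree.\<close>

lemma offdiag_zero_imp_scalar:
  assumes M: "M \<in> carrier_mat n n" and n: "n \<ge> 2"
    and z: "\<And>V. V \<in> unitary_mats n \<Longrightarrow> conj_mat V M $$ (0, 1) = 0"
  shows "scalar_mat M"
proof -
  have off: "B $$ (i, j) = 0"
    if B: "B \<in> carrier_mat n n" and zB: "\<And>V. V \<in> unitary_mats n \<Longrightarrow> conj_mat V B $$ (0, 1) = 0"
      and ij: "i < n" "j < n" "i \<noteq> j" for B i j
  proof -
    \<comment> \<open>The first transposition sends 0 to \<open>i\<close> and 1 to \<open>k\<close>;
      the second sends \<open>k\<close> to \<open>j\<close> and fixes \<open>i\<close>, which
      differs from both.\<close>
    define k where "k = Transposition.transpose 0 i (1 :: nat)"
    define p where "p = Transposition.transpose k j \<circ> Transposition.transpose 0 i"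
    have k: "k < n" "k \<noteq> i" using n ij by (auto simp: k_def Transposition.transpose_def)
    have p: "p permutes {..<n}"
      unfolding p_def using k ij n by (intro permutes_compose permutes_swap_id) auto
    have k': "Transposition.transpose 0 i (Suc 0) = k" by (simp add: k_def)
    have "p 0 = i" "p 1 = j" using k ij by (auto simp: p_def k')
    then show ?thesis
      using perm_unitary(2)[OF p B, of 0 1] zB[OF perm_unitary(1)[OF p]] n by simp
  qed
  have diag: "M $$ (i, i) = M $$ (j, j)" if ij: "i < n" "j < n" "i \<noteq> j" for i j
  proof -
    \<comment> \<open>Conjugating a diagonal matrix by \<open>I + (\<i> - 1) x x\<^sup>* / 2\<close> turns the difference of two diagonal
        entries into an off-diagonal entry.\<close>
    define x where "x = (\<lambda>k. if k = i \<or> k = j then 1 else 0 :: complex)"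
    let ?R = "rank_one_unitary n x \<i>"
    have "sqnorm n x = (\<Sum>k<n. (if k = i then 1 else 0) + (if k = j then 1 else 0))"
      unfolding sqnorm_def x_def using ij by (intro sum.cong) auto
    then have N: "sqnorm n x = 2" using ij by (simp add: sum.distrib)
    have R: "?R \<in> unitary_mats n" using N by (intro rank_one_unitary) auto
    have Rkl: "?R $$ (k, l) = (if k = l then 1 else 0) + (if {k, l} \<subseteq> {i, j} then (\<i> - 1) / 2 else 0)"
      if "k < n" "l < n" for k l
      using that by (simp add: rank_one_unitary_def N) (simp add: x_def)
    note Rc = unitary_matsD(1)[OF R]
    have "conj_mat ?R M $$ (i, j) = 0"
      using off[OF conj_mat_carrier[OF R M] _ ij] z by (simp add: conj_mat_conj_mat[OF _ R M] unitary_mult[OF R])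
    also have "conj_mat ?R M $$ (i, j)
        = (\<Sum>k<n. \<Sum>l<n. cnj (?R $$ (k, i)) * M $$ (k, l) * ?R $$ (l, j))"
      using M ij Rc by (intro conj_mat_index) auto
    also have "\<dots> = (\<Sum>k<n. \<Sum>l<n. if l = k then cnj (?R $$ (k, i)) * M $$ (k, k) * ?R $$ (k, j) else 0)"
      using off[OF M z] by (intro sum.cong) auto
    also have "\<dots> = (\<Sum>k<n. (if k = i then \<i> / 2 * M $$ (i, i) else 0) - (if k = j then \<i> / 2 * M $$ (j, j) else 0))"
      using ij by (intro sum.cong) (auto simp: Rkl field_simps)
    also have "\<dots> = \<i> / 2 * (M $$ (i, i) - M $$ (j, j))"
      using ij by (simp add: sum_subtractf algebra_simps)
    finally show ?thesis by simp
  qed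
  have "M = M $$ (0, 0) \<cdot>\<^sub>m 1\<^sub>m n"
  proof (rule eq_matI)
    fix i j assume "i < dim_row (M $$ (0, 0) \<cdot>\<^sub>m 1\<^sub>m n)" "j < dim_col (M $$ (0, 0) \<cdot>\<^sub>m 1\<^sub>m n)"
    then show "M $$ (i, j) = (M $$ (0, 0) \<cdot>\<^sub>m 1\<^sub>m n) $$ (i, j)"
      using off[OF M z, of i j] diag[of i 0] n by (cases "i = 0") auto
  qed (use M in auto)
  then show ?thesis using M unfolding scalar_mat_def by auto
qed

text \<open>The second claim follows from the first by swapping the first two basis vectors. Both
  positions occur because the products isolated below pair entry (0, 1) of one matrix with entry (1,
  0) of the other.\<close>

lemma nonscalar_offdiag:
  assumes M: "M \<in> carrier_mat n n" and n: "n \<ge> 2" and ns: "\<not> scalar_mat M"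
  shows "\<exists>V\<in>unitary_mats n. conj_mat V M $$ (0, 1) \<noteq> 0"
    and "\<exists>V\<in>unitary_mats n. conj_mat V M $$ (1, 0) \<noteq> 0"
proof -
  from offdiag_zero_imp_scalar[OF M n] ns
  obtain V where V: "V \<in> unitary_mats n" "conj_mat V M $$ (0, 1) \<noteq> 0" by auto
  then show "\<exists>V\<in>unitary_mats n. conj_mat V M $$ (0, 1) \<noteq> 0" by blast
  have p: "Transposition.transpose 0 1 permutes {..<n}" using n by (intro permutes_swap_id) auto
  let ?P = "Matrix.mat n n (\<lambda>(i, j). if i = Transposition.transpose 0 1 j then 1 else 0 :: complex)"
  have "conj_mat (V * ?P) M $$ (1, 0) = conj_mat V M $$ (0, 1)"
    using perm_unitary(2)[OF p, of "conj_mat V M" 1 0] perm_unitary(1)[OF p] V(1) M n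
    by (simp add: conj_mat_conj_mat)
  then show "\<exists>V\<in>unitary_mats n. conj_mat V M $$ (1, 0) \<noteq> 0"
    using V unitary_mult[OF V(1) perm_unitary(1)[OF p]] by (intro bexI[of _ "V * ?P"]) auto
qed

text \<open>An alternating sum over the signs of the first two diagonal entries of a diagonal unitary isolates
  the products of the \<open>(0,1)\<close> and \<open>(1,0)\<close> entries.\<close>

lemma numrange_four_points:
  assumes C: "C \<in> carrier_mat n n" and A: "A \<in> carrier_mat n n" and n: "n \<ge> 2"
    and U: "U \<in> unitary_mats n" and V: "V \<in> unitary_mats n" and w: "cmod w = 1"
  obtains z1 z2 z3 z4 where "{z1, z2, z3, z4} \<subseteq> C_numrange C A"
    "z1 - z2 - z3 + z4 = 4 * (w * (conj_mat U C $$ (0, 1) * conj_mat V A $$ (1, 0))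
       + cnj w * (conj_mat U C $$ (1, 0) * conj_mat V A $$ (0, 1)))"
proof -
  define B where "B = conj_mat U C"
  define E where "E = conj_mat V A"
  have BE: "B \<in> carrier_mat n n" "E \<in> carrier_mat n n" using C A U V by (auto simp: B_def E_def)
  \<comment> \<open>Diagonal of the unitary \<open>D a b\<close>: the entries \<open>a\<close>,
    \<open>b\<close>, and 1 from then on.\<close>
  define d where "d = (\<lambda>a b (k::nat). if k = 0 then a else if k = 1 then b else 1 :: complex)"
  define D where "D = (\<lambda>a b. mat_diag n (d a b))"
  define z where "z = (\<lambda>a b. mat_trace (B * conj_mat (D a b) E))"
  have Dc: "D a b \<in> carrier_mat n n" for a b by (simp add: D_def)
  have idx: "conj_mat (D a b) E $$ (i, j) = cnj (d a b i) * E $$ (i, j) * d a b j"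
    if "i < n" "j < n" for a b i j
  proof -
    have "conj_mat (D a b) E $$ (i, j)
        = (\<Sum>k<n. \<Sum>l<n. cnj (D a b $$ (k, i)) * E $$ (k, l) * D a b $$ (l, j))"
      using BE Dc that by (intro conj_mat_index)
    also have "\<dots> = (\<Sum>k<n. \<Sum>l<n. if k = i then (if l = j then cnj (d a b i) * E $$ (i, j) * d a b j else 0) else 0)"
      using that by (intro sum.cong refl) (auto simp: D_def mat_diag_def)
    also have "\<dots> = (\<Sum>k<n. if k = i then (\<Sum>l<n. if l = j then cnj (d a b i) * E $$ (i, j) * d a b j else 0) else 0)"
      by (intro sum.cong refl) auto
    finally show ?thesis using that by simp
  qed
  have Du: "D a b \<in> unitary_mats n" if "cmod a = 1" "cmod b = 1" for a b
  proof (rule unitary_matsI[OF Dc])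
    have dd: "d a b k * cnj (d a b k) = 1" for k
      using that by (simp add: d_def complex_norm_square[symmetric])
    show "mat_adjoint (D a b) * D a b = 1\<^sub>m n"
    proof (rule eq_matI)
      fix i j assume ij: "i < dim_row (1\<^sub>m n :: complex mat)" "j < dim_col (1\<^sub>m n :: complex mat)"
      then have "(mat_adjoint (D a b) * D a b) $$ (i, j)
          = (\<Sum>l<n. cnj (D a b $$ (l, i)) * D a b $$ (l, j))"
        by (simp add: adjoint_mult_self_index[OF Dc])
      also have "\<dots> = (\<Sum>l<n. if l = i then (if i = j then 1 else 0) else 0)"
        using ij dd by (intro sum.cong) (auto simp: D_def mat_diag_def mult.commute)
      finally show "(mat_adjoint (D a b) * D a b) $$ (i, j) = 1\<^sub>m n $$ (i, j)" using ij by simp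
    qed (simp_all add: carrier_matD[OF Dc])
  qed
  have zin: "z a b \<in> C_numrange C A" if "cmod a = 1" "cmod b = 1" for a b
    using C_numrange_conj[OF C A U unitary_mult[OF V Du[OF that]]]
    by (simp add: z_def B_def E_def conj_mat_conj_mat[OF Du[OF that] V A])
  have zsum: "z a b = (\<Sum>i<n. \<Sum>j<n. B $$ (i, j) * (cnj (d a b j) * E $$ (j, i) * d a b i))"
    if "cmod a = 1" "cmod b = 1" for a b
  proof -
    have "conj_mat (D a b) E \<in> carrier_mat n n" using BE Du[OF that] by simp
    then show ?thesis unfolding z_def
      by (subst mat_trace_mult[OF BE(1)]) (simp_all add: idx)
  qed
  let ?p = "B $$ (0, 1) * E $$ (1, 0)" and ?q = "B $$ (1, 0) * E $$ (0, 1)"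
  \<comment> \<open>The coefficient of \<open>B $$ (i, j) * E $$ (j, i)\<close> in the alternating
    sum over \<open>a = w, - w\<close> and \<open>b = 1, - 1\<close>. Only terms odd in both signs
    survive, namely those that couple the indices 0 and 1.\<close>
  define s where "s = (\<lambda>i j. d w 1 i * cnj (d w 1 j) - d (- w) 1 i * cnj (d (- w) 1 j)
    - d w (- 1) i * cnj (d w (- 1) j) + d (- w) (- 1) i * cnj (d (- w) (- 1) j))"
  have s: "s i j = (if i = 0 \<and> j = 1 then 4 * w else if i = 1 \<and> j = 0 then 4 * cnj w else 0)" for i j
    by (auto simp: s_def d_def)
  have "z w 1 - z (- w) 1 - z w (- 1) + z (- w) (- 1)
      = (\<Sum>i<n. \<Sum>j<n. B $$ (i, j) * E $$ (j, i) * s i j)"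
    using w unfolding s_def
    by (simp only: zsum norm_minus_cancel norm_one sum_subtractf[symmetric] sum.distrib[symmetric])
      (simp add: algebra_simps)
  also have "\<dots> = (\<Sum>i<n. \<Sum>j<n. if i = 0 then (if j = 1 then 4 * w * ?p else 0)
           else if i = 1 then (if j = 0 then 4 * cnj w * ?q else 0) else 0)"
    unfolding s by (intro sum.cong) auto
  also have "\<dots> = (\<Sum>i<n. if i = 0 then 4 * w * ?p else if i = 1 then 4 * cnj w * ?q else 0)"
    using n by (intro sum.cong) auto
  also have "\<dots> = (\<Sum>i<n. (if i = 0 then 4 * w * ?p else 0) + (if i = 1 then 4 * cnj w * ?q else 0))"
    by (intro sum.cong) auto
  also have "\<dots> = 4 * (w * ?p + cnj w * ?q)"
    using n by (simp add: sum.distrib algebra_simps)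
  finally show ?thesis
    unfolding B_def E_def
    by (rule that[rotated]) (simp add: zin w)
qed

section \<open>Numerical ranges in a point or on a line\<close>

text \<open>A matrix with at most one entry is scalar. The bound makes the indices 0 and 1
  available.\<close>

lemma nonscalar_dim_ge_2:
  assumes C: "C \<in> carrier_mat n n" and ns: "\<not> scalar_mat C"
  shows "n \<ge> 2"
proof (rule ccontr)
  assume "\<not> n \<ge> 2"
  then have "n = 0 \<or> n = 1" by auto
  then have "C = C $$ (0, 0) \<cdot>\<^sub>m 1\<^sub>m n" using C by (intro eq_matI) auto
  then show False using ns C unfolding scalar_mat_def by auto
qed

lemma numrange_scalar:
  assumes C: "C \<in> carrier_mat n n"
  shows "C_numrange C (\<nu> \<cdot>\<^sub>m 1\<^sub>m n) = {\<nu> * mat_trace C}"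
proof -
  have "conj_mat U (\<nu> \<cdot>\<^sub>m 1\<^sub>m n) = \<nu> \<cdot>\<^sub>m 1\<^sub>m n" if "U \<in> unitary_mats n" for U
    using unitary_matsD[OF that]
    by (simp add: conj_mat_def mult_smult_distrib[of _ n n _ n] mult_smult_assoc_mat[of _ n n _ n]
      right_mult_one_mat[of _ n n])
  moreover have "mat_trace (C * (\<nu> \<cdot>\<^sub>m 1\<^sub>m n)) = \<nu> * mat_trace C"
    using C by (simp add: mult_smult_distrib[of _ n n _ n] right_mult_one_mat[of _ n n])
      (simp add: mat_trace_def sum_distrib_left)
  moreover have "z \<in> C_numrange C (\<nu> \<cdot>\<^sub>m 1\<^sub>m n) \<longleftrightarrow>
      (\<exists>U\<in>unitary_mats n. z = mat_trace (C * conj_mat U (\<nu> \<cdot>\<^sub>m 1\<^sub>m n)))" for z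
    using C by (intro C_numrange_iff) auto
  ultimately show ?thesis using unitary_one[of n] by (auto cong: bex_cong)
qed

lemma numrange_nonempty: "A \<in> carrier_mat n n \<Longrightarrow> C_numrange C A \<noteq> {}"
  using unitary_one[of n] by (auto simp: C_numrange_def)

text \<open>For non-scalar \<open>A\<close>, independent bases make the entry (0, 1) of
  \<open>C\<close> and the entry (1, 0) of \<open>A\<close> both non-zero. In a one-point range
  every alternating sum vanishes, and so does their product, a contradiction.\<close>

lemma numrange_singleton_imp_scalar:
  assumes C: "C \<in> carrier_mat n n" and ns: "\<not> scalar_mat C"
    and A: "A \<in> carrier_mat n n" and W: "C_numrange C A \<subseteq> {\<mu>}"
  shows "scalar_mat A"
proof (rule ccontr)
  assume "\<not> scalar_mat A"
  note n = nonscalar_dim_ge_2[OF C ns]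
  obtain U where U: "U \<in> unitary_mats n" "conj_mat U C $$ (0, 1) \<noteq> 0"
    using nonscalar_offdiag(1)[OF C n ns] by blast
  obtain V where V: "V \<in> unitary_mats n" "conj_mat V A $$ (1, 0) \<noteq> 0"
    using nonscalar_offdiag(2)[OF A n \<open>\<not> scalar_mat A\<close>] by blast
  let ?p = "conj_mat U C $$ (0, 1) * conj_mat V A $$ (1, 0)"
    and ?q = "conj_mat U C $$ (1, 0) * conj_mat V A $$ (0, 1)"
  have *: "w * ?p + cnj w * ?q = 0" if "cmod w = 1" for w
    using numrange_four_points[OF C A n U(1) V(1) that] W by (smt (verit) add_diff_cancel_left'
      diff_add_cancel diff_self insert_subset mult_eq_0_iff singletonD subsetD zero_neq_numeral)
  \<comment> \<open>The values 1 and \<i> of \<open>w\<close> give the sum and, up to a factor, the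
    difference of the two products, which separates them.\<close>
  from *[of 1] *[of \<i>] have "?p + ?q = 0" "?p - ?q = 0"
    by (auto simp: algebra_simps)
  then have "2 * ?p = 0" by (simp add: algebra_simps)
  then show False using U V by simp
qed

text \<open>The base point \<open>p\<close> cancels in the alternating sum, which is therefore a
  real multiple of \<open>d\<close> for every \<open>w\<close>. Taking \<open>w\<close> to be 1 and
  \<i> shows that the two products divided by \<open>d\<close> are complex conjugates.\<close>

lemma numrange_line:
  assumes C: "C \<in> carrier_mat n n" and A: "A \<in> carrier_mat n n" and n: "n \<ge> 2"
    and U: "U \<in> unitary_mats n" and V: "V \<in> unitary_mats n" and d: "cmod d = 1"
    and W: "C_numrange C A \<subseteq> range (\<lambda>t. p + of_real t * d)"
  shows "conj_mat U C $$ (0, 1) * conj_mat V A $$ (1, 0)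
    = d\<^sup>2 * cnj (conj_mat U C $$ (1, 0) * conj_mat V A $$ (0, 1))"
proof -
  let ?p = "conj_mat U C $$ (0, 1) * conj_mat V A $$ (1, 0)"
    and ?q = "conj_mat U C $$ (1, 0) * conj_mat V A $$ (0, 1)"
  have *: "\<exists>r. w * ?p + cnj w * ?q = of_real r * d" if w: "cmod w = 1" for w
  proof -
    obtain z1 z2 z3 z4 where z: "{z1, z2, z3, z4} \<subseteq> C_numrange C A"
      and e: "z1 - z2 - z3 + z4 = 4 * (w * ?p + cnj w * ?q)"
      using numrange_four_points[OF C A n U V w] by metis
    from z W have "{z1, z2, z3, z4} \<subseteq> range (\<lambda>t. p + of_real t * d)" by blast
    then obtain t1 t2 t3 t4 where "z1 = p + of_real t1 * d" "z2 = p + of_real t2 * d"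
      "z3 = p + of_real t3 * d" "z4 = p + of_real t4 * d" by auto
    with e have "w * ?p + cnj w * ?q = of_real ((t1 - t2 - t3 + t4) / 4) * d"
      by (simp add: field_simps)
    then show ?thesis by blast
  qed
  from *[of 1] *[of \<i>] obtain r s where rs: "?p + ?q = of_real r * d" "\<i> * ?p - \<i> * ?q = of_real s * d"
    by auto
  have "2 * ?p = (?p + ?q) - \<i> * (\<i> * ?p - \<i> * ?q)" by (simp add: algebra_simps)
  then have p: "2 * ?p = (of_real r - \<i> * of_real s) * d" unfolding rs by (simp add: algebra_simps)
  have "2 * ?q = (?p + ?q) + \<i> * (\<i> * ?p - \<i> * ?q)" by (simp add: algebra_simps)
  then have q: "2 * ?q = (of_real r + \<i> * of_real s) * d" unfolding rs by (simp add: algebra_simps)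
  have dd: "d * cnj d = 1" using d by (simp add: complex_norm_square[symmetric])
  have "2 * (d\<^sup>2 * cnj ?q) = d\<^sup>2 * cnj (2 * ?q)" by simp
  also have "\<dots> = (of_real r - \<i> * of_real s) * d * (d * cnj d)"
    unfolding q by (simp add: power2_eq_square)
  also have "\<dots> = 2 * ?p" unfolding dd p by simp
  finally show ?thesis by simp
qed

text \<open>For \<open>\<kappa> = (cnj \<gamma>)\<^sup>2\<close> with a complex unit \<open>\<gamma>\<close> the conclusion says that \<open>\<gamma>\<close> times the
  trace-free part of \<open>M\<close> is Hermitian.\<close>

lemma ess_hermitian_of_offdiag:
  assumes M: "M \<in> carrier_mat n n" and n: "n \<ge> 2"
    and z: "\<And>V. V \<in> unitary_mats n \<Longrightarrow> conj_mat V M $$ (0, 1) = \<kappa> * cnj (conj_mat V M $$ (1, 0))"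
  shows "\<exists>s. \<forall>i<n. \<forall>j<n. M $$ (i, j) - \<kappa> * cnj (M $$ (j, i)) = (if i = j then s else 0)"
proof -
  define N where "N = Matrix.mat n n (\<lambda>(i, j). M $$ (i, j) - \<kappa> * cnj (M $$ (j, i)))"
  have N: "N \<in> carrier_mat n n" by (simp add: N_def)
  have "conj_mat V N $$ (0, 1) = 0" if V: "V \<in> unitary_mats n" for V
  proof -
    note Vc = unitary_matsD(1)[OF V]
    have "conj_mat V N $$ (0, 1)
        = (\<Sum>k<n. \<Sum>l<n. cnj (V $$ (k, 0)) * (M $$ (k, l) - \<kappa> * cnj (M $$ (l, k))) * V $$ (l, 1))"
      using n by (subst conj_mat_index[OF Vc N]) (auto simp: N_def)
    also have "\<dots> = (\<Sum>k<n. \<Sum>l<n. cnj (V $$ (k, 0)) * M $$ (k, l) * V $$ (l, 1))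
        - \<kappa> * (\<Sum>l<n. \<Sum>k<n. V $$ (l, 1) * cnj (M $$ (l, k)) * cnj (V $$ (k, 0)))"
      by (subst (3) sum.swap) (simp add: sum_subtractf sum_distrib_left algebra_simps)
    also have "\<dots> = conj_mat V M $$ (0, 1) - \<kappa> * cnj (conj_mat V M $$ (1, 0))"
      using n by (simp add: conj_mat_index[OF Vc M])
    finally show ?thesis using z[OF V] by simp
  qed
  from offdiag_zero_imp_scalar[OF N n this] obtain s where s: "N = s \<cdot>\<^sub>m 1\<^sub>m n"
    unfolding scalar_mat_def using N by auto
  have "M $$ (i, j) - \<kappa> * cnj (M $$ (j, i)) = (if i = j then s else 0)" if "i < n" "j < n" for i j
    using arg_cong[OF s, of "\<lambda>X. X $$ (i, j)"] that by (simp add: N_def)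
  then show ?thesis by blast
qed

section \<open>Trace-free parts and matrices that are Hermitian up to a unit and a scalar
  shift\<close>

lemma trace_free_part_index:
  assumes "M \<in> carrier_mat n n" "i < n" "j < n"
  shows "trace_free_part M $$ (i, j) = M $$ (i, j) - (if i = j then mat_trace M / of_nat n else 0)"
  using assms by (simp add: trace_free_part_def)

lemma trace_free_part_carrier [simp]: "M \<in> carrier_mat n n \<Longrightarrow> trace_free_part M \<in> carrier_mat n n"
  by (auto simp: trace_free_part_def)

lemma hermitian_smult_iff:
  assumes M: "M \<in> carrier_mat n n"
  shows "hermitian_mat (\<gamma> \<cdot>\<^sub>m M) \<longleftrightarrow> (\<forall>i<n. \<forall>j<n. \<gamma> * M $$ (i, j) = cnj (\<gamma> * M $$ (j, i)))"
proof -
  have "hermitian_mat (\<gamma> \<cdot>\<^sub>m M) \<longleftrightarrow>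
      (\<forall>i<n. \<forall>j<n. mat_adjoint (\<gamma> \<cdot>\<^sub>m M) $$ (i, j) = (\<gamma> \<cdot>\<^sub>m M) $$ (i, j))"
  proof
    assume r: "\<forall>i<n. \<forall>j<n. mat_adjoint (\<gamma> \<cdot>\<^sub>m M) $$ (i, j) = (\<gamma> \<cdot>\<^sub>m M) $$ (i, j)"
    show "hermitian_mat (\<gamma> \<cdot>\<^sub>m M)"
      unfolding hermitian_mat_def by (rule eq_matI) (use M r in simp_all)
  qed (simp add: hermitian_mat_def)
  then show ?thesis using M by (auto simp: eq_commute)
qed

text \<open>A multiple \<open>\<gamma> X\<close> is Hermitian exactly if \<open>X\<close> equals
  \<open>(cnj \<gamma>)^2\<close> times its adjoint. For the trace-free part of \<open>M\<close>,
  the terms with the trace only change the diagonal by a constant, which is collected in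
  \<open>s\<close>.\<close>

lemma hermitian_trace_free_iff:
  assumes M: "M \<in> carrier_mat n n" and g: "cmod \<gamma> = 1"
  shows "hermitian_mat (\<gamma> \<cdot>\<^sub>m trace_free_part M) \<longleftrightarrow>
    (\<exists>s. \<forall>i<n. \<forall>j<n. M $$ (i, j) - (cnj \<gamma>)\<^sup>2 * cnj (M $$ (j, i)) = (if i = j then s else 0))"
proof -
  define t where "t = mat_trace M / of_nat n"
  have gg: "\<gamma> * cnj \<gamma> = 1" using g by (simp add: complex_norm_square[symmetric])
  let ?M = "trace_free_part M"
  have eq: "\<gamma> * x = cnj (\<gamma> * y) \<longleftrightarrow> x - (cnj \<gamma>)\<^sup>2 * cnj y = 0" for x y
  proof -
    have "x - (cnj \<gamma>)\<^sup>2 * cnj y = cnj \<gamma> * (\<gamma> * x - cnj (\<gamma> * y))"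
      using gg by (simp add: algebra_simps power2_eq_square)
    then show ?thesis using gg by (metis complex_cnj_zero_iff mult_eq_0_iff right_minus_eq zero_neq_one)
  qed
  have "hermitian_mat (\<gamma> \<cdot>\<^sub>m ?M) \<longleftrightarrow>
      (\<forall>i<n. \<forall>j<n. ?M $$ (i, j) - (cnj \<gamma>)\<^sup>2 * cnj (?M $$ (j, i)) = 0)"
    using M by (simp only: hermitian_smult_iff[OF trace_free_part_carrier[OF M]] eq)
  also have "\<dots> \<longleftrightarrow> (\<forall>i<n. \<forall>j<n. M $$ (i, j) - (cnj \<gamma>)\<^sup>2 * cnj (M $$ (j, i))
      = (if i = j then t - (cnj \<gamma>)\<^sup>2 * cnj t else 0))"
    using M by (auto simp: trace_free_part_index t_def[symmetric] algebra_simps)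
  also have "\<dots> \<longleftrightarrow> (\<exists>s. \<forall>i<n. \<forall>j<n. M $$ (i, j) - (cnj \<gamma>)\<^sup>2 * cnj (M $$ (j, i)) = (if i = j then s else 0))"
  proof safe
    fix s i j
    assume s: "\<forall>i<n. \<forall>j<n. M $$ (i, j) - (cnj \<gamma>)\<^sup>2 * cnj (M $$ (j, i)) = (if i = j then s else 0)"
      and ij: "i < n" "j < n"
    \<comment> \<open>Summing the diagonal equations shows that \<open>s\<close> must be the
      constant coming from the trace.\<close>
    have "mat_trace M - (cnj \<gamma>)\<^sup>2 * cnj (mat_trace M) = (\<Sum>i<n. M $$ (i, i) - (cnj \<gamma>)\<^sup>2 * cnj (M $$ (i, i)))"
      using M by (simp add: mat_trace_def sum_subtractf sum_distrib_left)
    also have "\<dots> = of_nat n * s" using s by simp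
    finally have "t - (cnj \<gamma>)\<^sup>2 * cnj t = s" using ij by (simp add: t_def field_simps)
    then show "M $$ (i, j) - (cnj \<gamma>)\<^sup>2 * cnj (M $$ (j, i))
      = (if i = j then t - (cnj \<gamma>)\<^sup>2 * cnj t else 0)" using s ij by simp
  qed blast
  finally show ?thesis .
qed

lemma mat_trace_conj:
  assumes "U \<in> unitary_mats n" "A \<in> carrier_mat n n"
  shows "mat_trace (conj_mat U A) = mat_trace A"
proof -
  note U = unitary_matsD[OF assms(1)]
  have "mat_trace (conj_mat U A) = mat_trace (U * (mat_adjoint U * A))"
    unfolding conj_mat_def using U assms
    by (intro mat_trace_comm[of _ n n]) (auto simp: mult_carrier_mat[of _ n n _ n])
  also have "U * (mat_adjoint U * A) = A"
    using U assms by (simp add: assoc_mult_mat[of _ n n _ n _ n, symmetric] left_mult_one_mat[of _ n n])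
  finally show ?thesis .
qed

text \<open>The condition says that \<open>A\<close> minus a multiple of its adjoint is scalar, and
  unitary conjugation preserves adjoints and scalar matrices.\<close>

lemma hermitian_trace_free_conj:
  assumes A: "A \<in> carrier_mat n n" and U: "U \<in> unitary_mats n" and a: "cmod \<alpha> = 1"
    and h: "hermitian_mat (\<alpha> \<cdot>\<^sub>m trace_free_part A)"
  shows "hermitian_mat (\<alpha> \<cdot>\<^sub>m trace_free_part (conj_mat U A))"
proof -
  note Uc = unitary_matsD(1)[OF U]
  let ?k = "(cnj \<alpha>)\<^sup>2"
  from h obtain s where s: "\<And>i j. i < n \<Longrightarrow> j < n \<Longrightarrow>
      A $$ (i, j) - ?k * cnj (A $$ (j, i)) = (if i = j then s else 0)"
    unfolding hermitian_trace_free_iff[OF A a] by blast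
  have "conj_mat U A $$ (i, j) - ?k * cnj (conj_mat U A $$ (j, i)) = (if i = j then s else 0)"
    if ij: "i < n" "j < n" for i j
  proof -
    have "conj_mat U A $$ (i, j) - ?k * cnj (conj_mat U A $$ (j, i))
        = (\<Sum>k<n. \<Sum>l<n. cnj (U $$ (k, i)) * A $$ (k, l) * U $$ (l, j))
        - ?k * (\<Sum>l<n. \<Sum>k<n. U $$ (l, j) * cnj (A $$ (l, k)) * cnj (U $$ (k, i)))"
      using ij by (simp add: conj_mat_index[OF Uc A])
    also have "\<dots> = (\<Sum>k<n. \<Sum>l<n. cnj (U $$ (k, i)) * (A $$ (k, l) - ?k * cnj (A $$ (l, k))) * U $$ (l, j))"
      by (subst (2) sum.swap) (simp add: sum_subtractf sum_distrib_left algebra_simps)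
    also have "\<dots> = (\<Sum>k<n. \<Sum>l<n. if l = k then s * (cnj (U $$ (k, i)) * U $$ (k, j)) else 0)"
      by (intro sum.cong refl) (auto simp: s)
    also have "\<dots> = s * (mat_adjoint U * U) $$ (i, j)"
      unfolding adjoint_mult_self_index[OF Uc ij] by (simp add: sum_distrib_left)
    finally show ?thesis using unitary_matsD(2)[OF U] ij by simp
  qed
  then show ?thesis
    unfolding hermitian_trace_free_iff[OF conj_mat_carrier[OF U A] a] by blast
qed

text \<open>Once the traces are split off, the cross terms vanish and the trace of a product of two
  trace-free parts remains. Scaled by \<open>\<alpha> * \<gamma>\<close>, this is the trace of a
  product of two Hermitian matrices and hence real.\<close>

lemma trace_mult_ess_hermitian:
  assumes C: "C \<in> carrier_mat n n" and B: "B \<in> carrier_mat n n" and n: "n > 0"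
    and a: "cmod \<alpha> = 1" and g: "cmod \<gamma> = 1"
    and hC: "hermitian_mat (\<gamma> \<cdot>\<^sub>m trace_free_part C)"
    and hB: "hermitian_mat (\<alpha> \<cdot>\<^sub>m trace_free_part B)"
  shows "\<exists>r. mat_trace (C * B) = mat_trace C * mat_trace B / of_nat n + of_real r * cnj (\<alpha> * \<gamma>)"
proof -
  define c b where "c = (\<lambda>i j. trace_free_part C $$ (i, j))" and "b = (\<lambda>i j. trace_free_part B $$ (i, j))"
  define S where "S = (\<Sum>i<n. \<Sum>j<n. (\<gamma> * c i j) * (\<alpha> * b j i))"
  define s t where "s = mat_trace C / of_nat n" and "t = mat_trace B / of_nat n"
  have hc: "\<gamma> * c i j = cnj (\<gamma> * c j i)" if "i < n" "j < n" for i j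
    using hC[unfolded hermitian_smult_iff[OF trace_free_part_carrier[OF C]]] that unfolding c_def by blast
  have hb: "\<alpha> * b i j = cnj (\<alpha> * b j i)" if "i < n" "j < n" for i j
    using hB[unfolded hermitian_smult_iff[OF trace_free_part_carrier[OF B]]] that unfolding b_def by blast
  have "cnj S = (\<Sum>i<n. \<Sum>j<n. cnj (\<gamma> * c i j) * cnj (\<alpha> * b j i))"
    by (simp add: S_def)
  also have "\<dots> = (\<Sum>i<n. \<Sum>j<n. (\<gamma> * c j i) * (\<alpha> * b i j))"
    by (intro sum.cong refl) (simp only: hc[symmetric] hb[symmetric] lessThan_iff)
  also have "\<dots> = S" unfolding S_def by (rule sum.swap)
  finally obtain r where r: "S = of_real r" using Reals_cnj_iff[of S] by (auto elim: Reals_cases)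
  have tc: "(\<Sum>i<n. c i i) = 0" and tb: "(\<Sum>i<n. b i i) = 0"
    using C B n by (auto simp: c_def b_def trace_free_part_index sum_subtractf mat_trace_def)
  have "mat_trace (C * B) = (\<Sum>i<n. \<Sum>j<n. (c i j + (if i = j then s else 0)) * (b j i + (if j = i then t else 0)))"
    unfolding mat_trace_mult[OF C B] c_def b_def
    by (intro sum.cong refl) (simp add: trace_free_part_index[OF C] trace_free_part_index[OF B] s_def t_def)
  also have "\<dots> = (\<Sum>i<n. \<Sum>j<n. c i j * b j i + (if j = i then s * b i i + t * c i i + s * t else 0))"
    by (intro sum.cong refl) (auto simp: algebra_simps)
  also have "\<dots> = (\<Sum>i<n. \<Sum>j<n. c i j * b j i) + of_nat n * (s * t)"
    using tc tb by (simp add: sum.distrib sum_distrib_left[symmetric])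
  also have "(\<Sum>i<n. \<Sum>j<n. c i j * b j i) = cnj (\<alpha> * \<gamma>) * S"
  proof -
    have "\<alpha> * cnj \<alpha> = 1" "\<gamma> * cnj \<gamma> = 1" using a g by (simp_all add: complex_norm_square[symmetric])
    then have *: "cnj (\<alpha> * \<gamma>) * ((\<gamma> * x) * (\<alpha> * y)) = x * y" for x y
      by (metis (no_types, lifting) complex_cnj_mult mult.commute mult.left_commute mult_1)
    show ?thesis by (simp only: S_def sum_distrib_left *)
  qed
  finally show ?thesis using n unfolding r by (intro exI[of _ r]) (simp add: mult.commute s_def t_def)
qed

text \<open>An affine basis of \<open>L\<close> consists of two points; \<open>d\<close> is their
  normalized difference.\<close>

lemma straight_line_param:
  assumes "straight_line L"
  obtains p d :: complex where "cmod d = 1" "L = range (\<lambda>t. p + of_real t * d)"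
proof -
  obtain B where B: "\<not> affine_dependent B" "affine hull B = affine hull L"
    using affine_basis_exists by blast
  have L: "affine hull L = L" "aff_dim L = 1"
    using assms affine_hull_eq[of L] unfolding straight_line_def by blast+
  have "aff_dim L = int (card B) - 1" using aff_dim_unique[of B L] B by simp
  then have "card B = 2" using L by simp
  then obtain a b where ab: "B = {a, b}" "a \<noteq> b" by (auto simp: card_2_iff)
  define d where "d = (b - a) / of_real (cmod (b - a))"
  have ba: "b - a = of_real (cmod (b - a)) * d" "cmod (b - a) \<noteq> 0" using ab by (auto simp: d_def)
  have "L = range (\<lambda>u. a + u *\<^sub>R (b - a))"
    using L(1) B(2) unfolding ab(1) affine_hull_2_alt by metis
  also have "\<dots> = range (\<lambda>t. a + of_real t * d)"
  proof safe
    fix u show "a + u *\<^sub>R (b - a) \<in> range (\<lambda>t. a + of_real t * d)"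
      by (rule image_eqI[of _ _ "u * cmod (b - a)"]) (subst ba(1), simp_all add: scaleR_conv_of_real)
  next
    fix t show "a + of_real t * d \<in> range (\<lambda>u. a + u *\<^sub>R (b - a))"
      by (rule image_eqI[of _ _ "t / cmod (b - a)"]) (use ab in \<open>simp_all add: scaleR_conv_of_real d_def\<close>)
  qed
  finally have "L = range (\<lambda>t. a + of_real t * d)" .
  moreover have "cmod d = 1" using ba(2) by (simp add: d_def norm_divide)
  ultimately show ?thesis using that by blast
qed

lemma span_complex_singleton: "span {d :: complex} = range (\<lambda>t. of_real t * d)"
  by (auto simp: span_singleton scaleR_conv_of_real)

section \<open>Families whose range is a point or lies on a line\<close>

lemma numrange_family_singleton_iff:
  assumes C: "C \<in> carrier_mat n n" and ns: "\<not> scalar_mat C"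
    and F: "\<F> \<subseteq> carrier_mat n n" "\<F> \<noteq> {}"
  shows "C_numrange_family C \<F> = {\<mu>} \<longleftrightarrow> \<F> \<subseteq> {\<nu> \<cdot>\<^sub>m 1\<^sub>m n | \<nu>. \<nu> * mat_trace C = \<mu>}"
proof
  assume W: "C_numrange_family C \<F> = {\<mu>}"
  show "\<F> \<subseteq> {\<nu> \<cdot>\<^sub>m 1\<^sub>m n | \<nu>. \<nu> * mat_trace C = \<mu>}"
  proof
    fix A assume A: "A \<in> \<F>"
    then have Ac: "A \<in> carrier_mat n n" and WA: "C_numrange C A \<subseteq> {\<mu>}"
      using F W by (auto simp: C_numrange_family_def)
    from numrange_singleton_imp_scalar[OF C ns Ac WA] Ac obtain \<nu> where \<nu>: "A = \<nu> \<cdot>\<^sub>m 1\<^sub>m n"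
      by (auto simp: scalar_mat_def)
    with WA show "A \<in> {\<nu> \<cdot>\<^sub>m 1\<^sub>m n | \<nu>. \<nu> * mat_trace C = \<mu>}"
      using numrange_scalar[OF C, of \<nu>] by blast
  qed
next
  assume sub: "\<F> \<subseteq> {\<nu> \<cdot>\<^sub>m 1\<^sub>m n | \<nu>. \<nu> * mat_trace C = \<mu>}"
  have "C_numrange C A = {\<mu>}" if "A \<in> \<F>" for A
    using sub that numrange_scalar[OF C] by auto
  then show "C_numrange_family C \<F> = {\<mu>}" using F(2) by (auto simp: C_numrange_family_def)
qed

lemma unit_sqrt:
  assumes "cmod \<kappa> = 1"
  obtains \<gamma> where "cmod \<gamma> = 1" "(cnj \<gamma>)\<^sup>2 = \<kappa>"
proof
  show "cmod (cnj (csqrt \<kappa>)) = 1" "(cnj (cnj (csqrt \<kappa>)))\<^sup>2 = \<kappa>"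
    using assms by simp_all
qed

text \<open>A non-zero entry of a conjugate of \<open>A1\<close> turns the line relation into a
  relation between entries (0, 1) and (1, 0) of \<open>C\<close> with one constant
  \<open>\<kappa>\<close> for all bases. This makes \<open>C\<close> essentially Hermitian, and a
  non-zero entry of a conjugate of \<open>C\<close> then carries the property over to every member
  of \<open>\<F>\<close> with a common \<open>\<alpha>\<close>.\<close>

lemma numrange_in_line_imp_ess_hermitian:
  assumes C: "C \<in> carrier_mat n n" and ns: "\<not> scalar_mat C"
    and A1: "A1 \<in> \<F>" "\<not> scalar_mat A1" and F: "\<F> \<subseteq> carrier_mat n n" and d: "cmod d = 1"
    and W: "C_numrange_family C \<F> \<subseteq> range (\<lambda>t. p + of_real t * d)"
  shows "\<exists>\<alpha> \<gamma>. cmod \<alpha> = 1 \<and> cmod \<gamma> = 1 \<and> cnj (\<alpha> * \<gamma>) = d \<and>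
    hermitian_mat (\<gamma> \<cdot>\<^sub>m trace_free_part C) \<and>
    (\<forall>A\<in>\<F>. hermitian_mat (\<alpha> \<cdot>\<^sub>m trace_free_part A))"
proof -
  note n = nonscalar_dim_ge_2[OF C ns]
  have dd: "d * cnj d = 1" using d by (simp add: complex_norm_square[symmetric])
  have line: "conj_mat U C $$ (0, 1) * conj_mat V A $$ (1, 0)
      = d\<^sup>2 * cnj (conj_mat U C $$ (1, 0) * conj_mat V A $$ (0, 1))"
    if "A \<in> \<F>" "U \<in> unitary_mats n" "V \<in> unitary_mats n" for A U V
    using that F W d by (intro numrange_line[OF C _ n]) (auto simp: C_numrange_family_def)
  have A1c: "A1 \<in> carrier_mat n n" using A1 F by auto
  obtain V1 where V1: "V1 \<in> unitary_mats n" "conj_mat V1 A1 $$ (1, 0) \<noteq> 0"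
    using nonscalar_offdiag(2)[OF A1c n A1(2)] by blast
  \<comment> \<open>The line relation for \<open>A1\<close> in the basis \<open>V1\<close>, solved
    for the entry of \<open>C\<close>.\<close>
  define \<kappa> where "\<kappa> = d\<^sup>2 * cnj (conj_mat V1 A1 $$ (0, 1)) / conj_mat V1 A1 $$ (1, 0)"
  have kC: "conj_mat U C $$ (0, 1) = \<kappa> * cnj (conj_mat U C $$ (1, 0))" if "U \<in> unitary_mats n" for U
    using line[OF A1(1) that V1(1)] V1(2) by (simp add: \<kappa>_def field_simps)
  from ess_hermitian_of_offdiag[OF C n kC] obtain s where
    s: "\<And>i j. i < n \<Longrightarrow> j < n \<Longrightarrow> C $$ (i, j) - \<kappa> * cnj (C $$ (j, i)) = (if i = j then s else 0)"
    by blast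
  have k1: "cmod \<kappa> = 1"
  proof (rule ccontr)
    assume "cmod \<kappa> \<noteq> 1"
    have "1 - \<kappa> * cnj \<kappa> \<noteq> 0"
    proof
      assume "1 - \<kappa> * cnj \<kappa> = 0"
      then have "complex_of_real ((cmod \<kappa>)\<^sup>2) = 1" by (simp only: complex_norm_square) simp
      then have "(cmod \<kappa>)\<^sup>2 = 1" by (simp only: of_real_eq_1_iff)
      with \<open>cmod \<kappa> \<noteq> 1\<close> norm_ge_zero[of \<kappa>] show False unfolding power2_eq_1_iff by linarith
    qed
    \<comment> \<open>The equation for entry (j, i) is inserted into the one for (i, j). Unless
      \<open>\<kappa>\<close> is a unit, this determines \<open>C\<close> as a scalar
      matrix.\<close>
    moreover have "C $$ (i, j) * (1 - \<kappa> * cnj \<kappa>) = (if i = j then s + \<kappa> * cnj s else 0)"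
      if "i < n" "j < n" for i j
    proof -
      define e where "e = (if i = j then s else 0)"
      let ?x = "C $$ (i, j)"
      have x: "?x = e + \<kappa> * cnj (C $$ (j, i))" and y: "C $$ (j, i) = e + \<kappa> * cnj ?x"
        using s[OF that] s[OF that(2,1)] by (auto simp: e_def diff_eq_eq eq_commute[of j i])
      have "?x = e + \<kappa> * cnj (e + \<kappa> * cnj ?x)"
        unfolding y[symmetric] by (rule x)
      then have "?x - (e + \<kappa> * cnj (e + \<kappa> * cnj ?x)) = 0" by (rule iffD2[OF right_minus_eq])
      moreover have "?x * (1 - \<kappa> * cnj \<kappa>) = ?x - (e + \<kappa> * cnj (e + \<kappa> * cnj ?x)) + (e + \<kappa> * cnj e)"
        by (simp add: algebra_simps)
      ultimately show ?thesis by (auto simp: e_def)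
    qed
    ultimately have "C $$ (i, j) = (if i = j then s + \<kappa> * cnj s else 0) / (1 - \<kappa> * cnj \<kappa>)"
      if "i < n" "j < n" for i j using that by (simp only: eq_divide_eq if_False) simp
    then have "C = ((s + \<kappa> * cnj s) / (1 - \<kappa> * cnj \<kappa>)) \<cdot>\<^sub>m 1\<^sub>m n"
      using C by (intro eq_matI) auto
    with ns C show False unfolding scalar_mat_def by auto
  qed
  then have kk: "\<kappa> * cnj \<kappa> = 1" by (simp add: complex_norm_square[symmetric])
  obtain \<gamma> where g: "cmod \<gamma> = 1" "(cnj \<gamma>)\<^sup>2 = \<kappa>" using unit_sqrt[OF k1] .
  have gg: "\<gamma> * cnj \<gamma> = 1" using g(1) by (simp add: complex_norm_square[symmetric])
  \<comment> \<open>The only choice compatible with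
    \<open>cnj (\<alpha> * \<gamma>) = d\<close>.\<close>
  define \<alpha> where "\<alpha> = cnj \<gamma> * cnj d"
  have a: "cmod \<alpha> = 1" using g(1) d by (simp add: \<alpha>_def norm_mult)
  have a2: "(cnj \<alpha>)\<^sup>2 = cnj \<kappa> * d\<^sup>2" unfolding g(2)[symmetric] by (simp add: \<alpha>_def power_mult_distrib)
  obtain U where U: "U \<in> unitary_mats n" "conj_mat U C $$ (1, 0) \<noteq> 0"
    using nonscalar_offdiag(2)[OF C n ns] by blast
  have "hermitian_mat (\<alpha> \<cdot>\<^sub>m trace_free_part A)" if A: "A \<in> \<F>" for A
  proof -
    have Ac: "A \<in> carrier_mat n n" using A F by auto
    have "conj_mat V A $$ (0, 1) = (cnj \<alpha>)\<^sup>2 * cnj (conj_mat V A $$ (1, 0))"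
      if V: "V \<in> unitary_mats n" for V
    proof -
      let ?x = "conj_mat V A $$ (1, 0)" and ?y = "conj_mat V A $$ (0, 1)"
      \<comment> \<open>The entry (0, 1) of \<open>C\<close> is replaced through \<open>kC\<close>,
        and the non-zero conjugate of its entry (1, 0) is cancelled.\<close>
      have "\<kappa> * ?x = d\<^sup>2 * cnj ?y"
        using line[OF A U(1) V] kC[OF U(1)] U(2) by simp
      then have "cnj \<kappa> * cnj ?x = (cnj d)\<^sup>2 * ?y"
        by (metis complex_cnj_mult complex_cnj_cnj complex_cnj_power)
      then have "d\<^sup>2 * (cnj \<kappa> * cnj ?x) = (d * cnj d)\<^sup>2 * ?y" by (simp add: power_mult_distrib)
      then show ?thesis by (simp add: a2 dd mult_ac)
    qed
    from ess_hermitian_of_offdiag[OF Ac n this] show ?thesis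
      by (simp only: hermitian_trace_free_iff[OF Ac a])
  qed
  moreover have "hermitian_mat (\<gamma> \<cdot>\<^sub>m trace_free_part C)"
    unfolding hermitian_trace_free_iff[OF C g(1)] g(2) using s by blast
  moreover have "cnj (\<alpha> * \<gamma>) = (\<gamma> * cnj \<gamma>) * d" by (simp add: \<alpha>_def)
  then have "cnj (\<alpha> * \<gamma>) = d" unfolding gg by simp
  ultimately show ?thesis using a g(1) by blast
qed

text \<open>Conjugating \<open>A\<close> keeps both its trace and the Hermitian condition, so the
  formula for the trace of a product has the same centre and the same direction at every point of
  the range.\<close>

lemma numrange_ess_hermitian:
  assumes C: "C \<in> carrier_mat n n" and ns: "\<not> scalar_mat C" and A: "A \<in> carrier_mat n n"
    and ag: "cmod \<alpha> = 1" "cmod \<gamma> = 1"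
    and hC: "hermitian_mat (\<gamma> \<cdot>\<^sub>m trace_free_part C)"
    and hA: "hermitian_mat (\<alpha> \<cdot>\<^sub>m trace_free_part A)"
    and z: "z \<in> C_numrange C A"
  shows "z - mat_trace C * mat_trace A / of_nat n \<in> span {cnj (\<alpha> * \<gamma>)}"
proof -
  have n: "n > 0" using nonscalar_dim_ge_2[OF C ns] by simp
  from z obtain U where U: "U \<in> unitary_mats n" "z = mat_trace (C * conj_mat U A)"
    by (auto simp: C_numrange_iff[OF A C])
  from trace_mult_ess_hermitian[OF C conj_mat_carrier[OF U(1) A] n ag hC
      hermitian_trace_free_conj[OF A U(1) ag(1) hA]]
  show ?thesis unfolding U(2) mat_trace_conj[OF U(1) A] span_complex_singleton by auto
qed

text \<open>If all members are scalar, their ranges are single points and (i) results. A non-scalar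
  member yields (ii), with units whose direction is that of \<open>L\<close>. Conversely, in (ii)
  each range lies on the line through its centre in that direction, and this line is
  \<open>L\<close>.\<close>

lemma numrange_family_line_iff:
  assumes C: "C \<in> carrier_mat n n" and ns: "\<not> scalar_mat C"
    and F: "\<F> \<subseteq> carrier_mat n n" and L: "straight_line L"
  shows "C_numrange_family C \<F> \<subseteq> L \<longleftrightarrow>
          \<F> \<subseteq> {\<nu> \<cdot>\<^sub>m 1\<^sub>m n | \<nu>. \<nu> * mat_trace C \<in> L} \<or>
          (\<exists>\<alpha> \<gamma>. cmod \<alpha> = 1 \<and> cmod \<gamma> = 1 \<and>
             hermitian_mat (\<gamma> \<cdot>\<^sub>m trace_free_part C) \<and>
             (\<forall>A\<in>\<F>. hermitian_mat (\<alpha> \<cdot>\<^sub>m trace_free_part A)) \<and>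
             {mat_trace C * mat_trace A / of_nat n | A. A \<in> \<F>} \<subseteq> L \<and>
             affine_parallel L (span {cnj (\<alpha> * \<gamma>)}))" (is "_ \<longleftrightarrow> ?i \<or> ?ii")
proof -
  obtain p d where d: "cmod d = 1" and Lp: "L = range (\<lambda>t. p + of_real t * d)"
    using straight_line_param[OF L] .
  have "?i \<or> ?ii" if W: "C_numrange_family C \<F> \<subseteq> L"
  proof (cases "\<exists>A\<in>\<F>. \<not> scalar_mat A")
    case True
    then obtain A1 where A1: "A1 \<in> \<F>" "\<not> scalar_mat A1" by blast
    obtain \<alpha> \<gamma> where ag: "cmod \<alpha> = 1" "cmod \<gamma> = 1" "cnj (\<alpha> * \<gamma>) = d"
      and h: "hermitian_mat (\<gamma> \<cdot>\<^sub>m trace_free_part C)"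
        "\<And>A. A \<in> \<F> \<Longrightarrow> hermitian_mat (\<alpha> \<cdot>\<^sub>m trace_free_part A)"
      using numrange_in_line_imp_ess_hermitian[OF C ns A1 F d W[unfolded Lp]] by blast
    have "mat_trace C * mat_trace A / of_nat n \<in> L" if A: "A \<in> \<F>" for A
    proof -
      have Ac: "A \<in> carrier_mat n n" using A F by auto
      obtain z where z: "z \<in> C_numrange C A" using numrange_nonempty[OF Ac] by blast
      then have "z \<in> L" using W A by (auto simp: C_numrange_family_def)
      then obtain t where t: "z = p + of_real t * d" unfolding Lp by blast
      obtain r where "z - mat_trace C * mat_trace A / of_nat n = of_real r * d"
        using numrange_ess_hermitian[OF C ns Ac ag(1,2) h(1) h(2)[OF A] z]
        unfolding ag(3) span_complex_singleton by blast
      then have "mat_trace C * mat_trace A / of_nat n = p + of_real (t - r) * d"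
        using t by (simp add: algebra_simps)
      then show ?thesis unfolding Lp by blast
    qed
    moreover have "affine_parallel L (span {cnj (\<alpha> * \<gamma>)})"
      unfolding affine_parallel_def ag(3) span_complex_singleton Lp
      by (intro exI[of _ "- p"]) (auto simp: image_image)
    ultimately have ?ii using ag h by blast
    then show ?thesis ..
  next
    case False
    have "A \<in> {\<nu> \<cdot>\<^sub>m 1\<^sub>m n | \<nu>. \<nu> * mat_trace C \<in> L}" if A: "A \<in> \<F>" for A
    proof -
      have "A \<in> carrier_mat n n" "scalar_mat A" using A F False by auto
      then obtain \<nu> where \<nu>: "A = \<nu> \<cdot>\<^sub>m 1\<^sub>m n" unfolding scalar_mat_def by auto
      have "C_numrange C A \<subseteq> L" using A W by (auto simp: C_numrange_family_def)
      then show ?thesis unfolding \<nu> numrange_scalar[OF C] by blast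
    qed
    then show ?thesis by blast
  qed
  moreover have "C_numrange_family C \<F> \<subseteq> L" if ?i
  proof -
    have "C_numrange C A \<subseteq> L" if "A \<in> \<F>" for A
      using \<open>?i\<close> that numrange_scalar[OF C] by auto
    then show ?thesis by (auto simp: C_numrange_family_def)
  qed
  moreover have "C_numrange_family C \<F> \<subseteq> L" if ?ii
  proof -
    from that obtain \<alpha> \<gamma> where ag: "cmod \<alpha> = 1" "cmod \<gamma> = 1"
      and hC: "hermitian_mat (\<gamma> \<cdot>\<^sub>m trace_free_part C)"
      and hA: "\<And>A. A \<in> \<F> \<Longrightarrow> hermitian_mat (\<alpha> \<cdot>\<^sub>m trace_free_part A)"
      and tr: "\<And>A. A \<in> \<F> \<Longrightarrow> mat_trace C * mat_trace A / of_nat n \<in> L"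
      and par: "affine_parallel L (span {cnj (\<alpha> * \<gamma>)})" by blast
    from par obtain a where a: "span {cnj (\<alpha> * \<gamma>)} = (\<lambda>x. a + x) ` L"
      unfolding affine_parallel_def by blast
    have "z \<in> L" if A: "A \<in> \<F>" and z: "z \<in> C_numrange C A" for A z
    proof -
      let ?m = "mat_trace C * mat_trace A / of_nat n"
      have "z - ?m \<in> span {cnj (\<alpha> * \<gamma>)}"
        using A F by (intro numrange_ess_hermitian[OF C ns _ ag hC hA[OF A] z]) auto
      moreover have "a + ?m \<in> span {cnj (\<alpha> * \<gamma>)}" using tr[OF A] a by blast
      \<comment> \<open>The translation by \<open>a\<close> takes \<open>L\<close> to the span, so
        membership of \<open>a + z\<close> in the span gives \<open>z \<in> L\<close>.\<close>
      ultimately have "(z - ?m) + (a + ?m) \<in> span {cnj (\<alpha> * \<gamma>)}" by (rule span_add)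
      then show ?thesis unfolding a by auto
    qed
    then show ?thesis by (auto simp: C_numrange_family_def)
  qed
  ultimately show ?thesis by blast
qed

section \<open>Corners of a numerical range\<close>

text \<open>The norm bound expresses that the tangent cone of \<open>P\<close> at \<open>v\<close> contains no line.\<close>

lemma polytope_extreme_point_cone:
  fixes P :: "'a::euclidean_space set"
  assumes P: "polytope P" and v: "v extreme_point_of P"
  obtains a where "\<And>p. p \<in> P \<Longrightarrow> norm (p - v) \<le> inner a (p - v)"
proof -
  from P obtain S where S: "finite S" "P = convex hull S" by (auto simp: polytope_def)
  define T where "T = S - {v}"
  have T: "finite T" using S by (simp add: T_def)
  have cP: "convex P" using S by (simp add: convex_convex_hull)
  \<comment> \<open>Extremality keeps \<open>v\<close> outside the hull of the other generators, so
    a hyperplane separates it strictly from that compact set.\<close>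
  then have "convex (P - {v})" using v by (simp add: extreme_point_of_stillconvex)
  moreover have "T \<subseteq> P - {v}" using S hull_subset[of S convex] by (auto simp: T_def)
  ultimately have "convex hull T \<subseteq> P - {v}" by (rule hull_minimal[rotated])
  then have "v \<notin> convex hull T" by blast
  moreover have "closed (convex hull T)" using T by (simp add: finite_imp_compact_convex_hull compact_imp_closed)
  ultimately obtain a b where ab: "inner a v < b" "\<And>x. x \<in> convex hull T \<Longrightarrow> b < inner a x"
    using separating_hyperplane_closed_point[OF convex_convex_hull] by blast
  define M where "M = (\<Sum>s\<in>T. norm (s - v))"
  \<comment> \<open>Scales the separating functional so that its increase from \<open>v\<close> to
    any other generator is at least \<open>M\<close>, a bound for all the distances.\<close>
  define K where "K = M / (b - inner a v)"
  have M: "norm (s - v) \<le> M" if "s \<in> T" for s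
    unfolding M_def using T that by (intro member_le_sum) auto
  have K0: "K \<ge> 0" using ab by (auto simp: K_def M_def intro!: divide_nonneg_pos sum_nonneg)
  \<comment> \<open>The desired bound cuts out a convex set, so it suffices to verify it at the
    generators.\<close>
  define Q where "Q = {p. norm (p - v) \<le> inner (K *\<^sub>R a) (p - v)}"
  have "convex Q"
  proof (rule convexI)
    fix x y and u w :: real assume xy: "x \<in> Q" "y \<in> Q" and uw: "0 \<le> u" "0 \<le> w" "u + w = 1"
    have e: "u *\<^sub>R x + w *\<^sub>R y - v = u *\<^sub>R (x - v) + w *\<^sub>R (y - v)"
      using uw(3) by (simp add: algebra_simps flip: scaleR_add_left)
    have "norm (u *\<^sub>R x + w *\<^sub>R y - v) \<le> u * norm (x - v) + w * norm (y - v)"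
      unfolding e using norm_triangle_ineq[of "u *\<^sub>R (x - v)" "w *\<^sub>R (y - v)"] uw by simp
    also have "\<dots> \<le> u * (inner (K *\<^sub>R a) (x - v)) + w * (inner (K *\<^sub>R a) (y - v))"
      using xy uw unfolding Q_def by (intro add_mono mult_left_mono) auto
    also have "\<dots> = inner (K *\<^sub>R a) (u *\<^sub>R x + w *\<^sub>R y - v)"
      unfolding e by (simp add: inner_add_right)
    finally show "u *\<^sub>R x + w *\<^sub>R y \<in> Q" by (simp add: Q_def)
  qed
  moreover have "S \<subseteq> Q"
  proof
    fix s assume "s \<in> S"
    show "s \<in> Q"
    proof (cases "s = v")
      case False
      then have s: "s \<in> T" using \<open>s \<in> S\<close> by (simp add: T_def)
      then have "b < inner a s" using ab(2) hull_inc by metis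
      have "norm (s - v) \<le> K * (b - inner a v)" using M[OF s] ab(1) by (simp add: K_def)
      also have "\<dots> \<le> K * (inner a s - inner a v)" using \<open>b < inner a s\<close> K0 by (intro mult_left_mono) auto
      finally show ?thesis by (simp add: Q_def inner_diff_right algebra_simps)
    qed (simp add: Q_def)
  qed
  ultimately have "P \<subseteq> Q" unfolding S(2) by (rule hull_minimal[rotated])
  then show ?thesis by (intro that[of "K *\<^sub>R a"]) (auto simp: Q_def)
qed

section \<open>Curves of rank-one unitaries through a corner\<close>

definition qform :: "nat \<Rightarrow> complex mat \<Rightarrow> (nat \<Rightarrow> complex) \<Rightarrow> complex" where
  "qform n M x = (\<Sum>i<n. \<Sum>j<n. cnj (x i) * M $$ (i, j) * x j)"

lemma mat_trace_add: "A \<in> carrier_mat n n \<Longrightarrow> B \<in> carrier_mat n n \<Longrightarrow> mat_trace (A + B) = mat_trace A + mat_trace B"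
  by (simp add: mat_trace_def sum.distrib)

lemma mat_trace_smult: "A \<in> carrier_mat n n \<Longrightarrow> mat_trace (c \<cdot>\<^sub>m A) = c * mat_trace A"
  by (simp add: mat_trace_def sum_distrib_left)

text \<open>With \<open>P = x x^*\<close>, the product \<open>P A P\<close> is a multiple of
  \<open>P\<close>, and the trace of \<open>M P\<close> is the form of \<open>M\<close> at
  \<open>x\<close>. The forms of \<open>C * A\<close> and \<open>A * C\<close> appear as the
  coefficients of \<open>s\<close> and \<open>cnj s\<close>, where a corner condition can compare
  them.\<close>

lemma trace_rank_one:
  fixes x :: "nat \<Rightarrow> complex" and w :: complex
  assumes C: "C \<in> carrier_mat n n" and A: "A \<in> carrier_mat n n"
  defines "s \<equiv> (w - 1) / sqnorm n x"
  shows "mat_trace (C * conj_mat (rank_one_unitary n x w) A)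
    = mat_trace (C * A) + s * qform n (C * A) x + cnj s * qform n (A * C) x
      + s * cnj s * (qform n A x * qform n C x)"
proof -
  define P where "P = Matrix.mat n n (\<lambda>(i, j). x i * cnj (x j))"
  let ?R = "rank_one_unitary n x w"
  have P: "P \<in> carrier_mat n n" by (simp add: P_def)
  note car = C A P mult_carrier_mat[of _ n n _ n] one_carrier_mat[of n] add_carrier_mat smult_carrier_mat
  note a = assoc_mult_mat[of _ n n _ n _ n]
  have R: "?R = 1\<^sub>m n + s \<cdot>\<^sub>m P"
    by (rule eq_matI) (auto simp: rank_one_unitary_def P_def s_def)
  have Ra: "mat_adjoint ?R = 1\<^sub>m n + cnj s \<cdot>\<^sub>m P"
    by (rule eq_matI) (auto simp: rank_one_unitary_def P_def s_def)
  have qP: "mat_trace (M * P) = qform n M x" if "M \<in> carrier_mat n n" for M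
    unfolding mat_trace_mult[OF that P] qform_def
    by (intro sum.cong refl) (simp add: P_def mult_ac)
  have PAP: "P * (A * P) = qform n A x \<cdot>\<^sub>m P"
  proof (rule eq_matI)
    fix i j assume "i < dim_row (qform n A x \<cdot>\<^sub>m P)" "j < dim_col (qform n A x \<cdot>\<^sub>m P)"
    then have ij: "i < n" "j < n" using P by auto
    have "(P * (A * P)) $$ (i, j) = (\<Sum>k<n. P $$ (i, k) * (A * P) $$ (k, j))"
      using ij car by (intro index_mult_mat_sum)
    also have "\<dots> = (\<Sum>k<n. P $$ (i, k) * (\<Sum>l<n. A $$ (k, l) * P $$ (l, j)))"
      using ij by (intro sum.cong refl) (simp only: index_mult_mat_sum[OF A P] lessThan_iff)
    also have "\<dots> = qform n A x * (x i * cnj (x j))"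
      using ij by (simp add: P_def qform_def sum_distrib_left sum_distrib_right mult_ac)
    finally show "(P * (A * P)) $$ (i, j) = (qform n A x \<cdot>\<^sub>m P) $$ (i, j)" using ij by (simp add: P_def)
  qed (use P A in auto)
  have left: "(1\<^sub>m n + cnj s \<cdot>\<^sub>m P) * X = X + cnj s \<cdot>\<^sub>m (P * X)" if "X \<in> carrier_mat n n" for X
    using car that by (simp add: add_mult_distrib_mat[of _ n n _ _ n]
      mult_smult_assoc_mat[of _ n n _ n] left_mult_one_mat[of _ n n])
  have "conj_mat ?R A = (1\<^sub>m n + cnj s \<cdot>\<^sub>m P) * (A * (1\<^sub>m n + s \<cdot>\<^sub>m P))"
    unfolding conj_mat_def Ra unfolding R using car by (intro a) auto
  also have "A * (1\<^sub>m n + s \<cdot>\<^sub>m P) = A + s \<cdot>\<^sub>m (A * P)"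
    using car by (simp add: mult_add_distrib_mat[of _ n n _ n] mult_smult_distrib[of _ n n _ n])
  also have "(1\<^sub>m n + cnj s \<cdot>\<^sub>m P) * (A + s \<cdot>\<^sub>m (A * P))
      = (A + s \<cdot>\<^sub>m (A * P)) + cnj s \<cdot>\<^sub>m (P * (A + s \<cdot>\<^sub>m (A * P)))"
    using car by (intro left) simp
  also have "P * (A + s \<cdot>\<^sub>m (A * P)) = P * A + s \<cdot>\<^sub>m (P * (A * P))"
    using car by (simp add: mult_add_distrib_mat[of _ n n _ n] mult_smult_distrib[of _ n n _ n])
  finally have "C * conj_mat ?R A = (C * A + s \<cdot>\<^sub>m (C * (A * P))) + cnj s \<cdot>\<^sub>m (C * (P * A) + s \<cdot>\<^sub>m (C * (P * (A * P))))"
    using car by (simp add: assoc_add_mat[of _ n n] mult_add_distrib_mat[of _ n n _ n] mult_smult_distrib[of _ n n _ n])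
  then have "mat_trace (C * conj_mat ?R A) = mat_trace (C * A) + s * mat_trace (C * (A * P))
      + cnj s * (mat_trace (C * (P * A)) + s * mat_trace (C * (P * (A * P))))"
    using car by (simp add: mat_trace_add[of _ n] mat_trace_smult[of _ n])
  also have "mat_trace (C * (A * P)) = qform n (C * A) x"
    using car qP[of "C * A"] by (simp add: a)
  also have "mat_trace (C * (P * A)) = mat_trace ((P * A) * C)"
    using car by (intro mat_trace_comm) auto
  also have "\<dots> = mat_trace (P * (A * C))" using car by (simp add: a)
  also have "\<dots> = mat_trace ((A * C) * P)" using car by (intro mat_trace_comm) auto
  also have "\<dots> = qform n (A * C) x" using car by (intro qP) auto
  also have "mat_trace (C * (P * (A * P))) = qform n A x * qform n C x"
    unfolding PAP using car by (simp add: mult_smult_distrib[of _ n n _ n] mat_trace_smult[of _ n] qP)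
  finally show ?thesis by (simp add: algebra_simps)
qed

text \<open>The points for \<open>cis t\<close> and \<open>cis (- t)\<close> differ to first order
  in \<open>t\<close> unless \<open>b = c\<close>, whereas their displacements from \<open>v\<close>
  add up to a second-order term. The cone bound at \<open>v\<close> estimates the former by the
  latter, and \<open>t\<close> tends to 0.\<close>

lemma corner_imp_eq:
  fixes b c q v :: complex and N :: real
  assumes P: "polytope P" and v: "v extreme_point_of P" and N: "N > 0"
    and f: "\<And>w. cmod w = 1 \<Longrightarrow> v + (w - 1) / of_real N * b + cnj ((w - 1) / of_real N) * c
       + (w - 1) / of_real N * cnj ((w - 1) / of_real N) * q \<in> P"
  shows "b = c"
proof -
  obtain a where a: "\<And>p. p \<in> P \<Longrightarrow> norm (p - v) \<le> inner a (p - v)"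
    using polytope_extreme_point_cone[OF P v] by blast
  \<comment> \<open>The sum of the two displacements will be \<open>s * cnj s\<close> times
    \<open>e\<close>.\<close>
  define e where "e = 2 * q - of_real N * (b + c)"
  define M where "M = (inner a e) / N"
  have *: "sin t * cmod (b - c) \<le> (1 - cos t) * M" for t
  proof -
    define s where "s = (cis t - 1) / of_real N"
    have ss: "s * cnj s = of_real ((2 - 2 * cos t) / N\<^sup>2)"
    proof -
      have "(cis t - 1) * cnj (cis t - 1) = of_real (2 - 2 * cos t)"
        using sin_cos_squared_add[of t]
        by (simp add: complex_eq_iff power2_eq_square algebra_simps)
      then show ?thesis by (simp add: s_def power2_eq_square)
    qed
    \<comment> \<open>The unit circle is tangent to the imaginary direction at 1, so the real part
      of \<open>s\<close> is already of second order.\<close>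
    have sp: "s + cnj s = - of_real N * (s * cnj s)"
      unfolding ss using N by (simp add: s_def complex_eq_iff power2_eq_square field_simps)
    have sm: "s - cnj s = \<i> * of_real (2 * sin t / N)"
      by (simp add: s_def complex_eq_iff)
    let ?g = "s * b + cnj s * c + s * cnj s * q" and ?h = "cnj s * b + s * c + s * cnj s * q"
    have "cnj s = (cis (- t) - 1) / of_real N" by (simp add: s_def cis_cnj)
    then have gh: "v + ?g \<in> P" "v + ?h \<in> P"
      using f[of "cis t"] f[of "cis (- t)"]
      by (simp_all add: s_def[symmetric] add.assoc mult.commute) (simp_all add: s_def cis_cnj mult_ac)
    have "2 * sin t / N * cmod (b - c) \<le> cmod (?g - ?h)"
    proof -
      have "?g - ?h = (s - cnj s) * (b - c)" by (simp add: algebra_simps)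
      then have "cmod (?g - ?h) = \<bar>2 * sin t / N\<bar> * cmod (b - c)"
        unfolding sm by (simp only: norm_mult norm_ii norm_of_real mult_1)
      moreover have "2 * sin t / N * cmod (b - c) \<le> \<bar>2 * sin t / N\<bar> * cmod (b - c)"
        by (intro mult_right_mono abs_ge_self norm_ge_zero)
      ultimately show ?thesis by simp
    qed
    also have "\<dots> \<le> cmod ?g + cmod ?h" by (rule norm_triangle_ineq4)
    also have "\<dots> \<le> inner a (?g + ?h)" using a[OF gh(1)] a[OF gh(2)] inner_add_right[of a ?g ?h]
      by (simp only: add_diff_cancel_left')
    also have "?g + ?h = (s + cnj s) * (b + c) + 2 * (s * cnj s) * q" by (simp add: algebra_simps)
    also have "\<dots> = (s * cnj s) * e" unfolding sp e_def by (simp add: algebra_simps)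
    also have "\<dots> = ((2 - 2 * cos t) / N\<^sup>2) *\<^sub>R e" unfolding ss by (simp only: scaleR_conv_of_real)
    also have "inner a \<dots> = 2 * ((1 - cos t) * M) / N" by (simp add: M_def power2_eq_square algebra_simps)
    finally show ?thesis using N by (simp add: field_simps)
  qed
  have "((\<lambda>t::real. (1 - cos t) / sin t * M) \<longlongrightarrow> 0) (at_right 0)" by real_asymp
  moreover have "\<forall>\<^sub>F t in at_right (0::real). cmod (b - c) \<le> (1 - cos t) / sin t * M"
  proof -
    have "\<forall>\<^sub>F t in at_right (0::real). sin t > 0" by real_asymp
    then show ?thesis by eventually_elim (use * in \<open>simp add: field_simps\<close>)
  qed
  ultimately have "cmod (b - c) \<le> 0" by (intro tendsto_lowerbound) auto
  then show ?thesis by simp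
qed

text \<open>Polarization: basis vectors give the diagonal, and sums of one basis vector with 1 or
  \<i> times another give the off-diagonal entries.\<close>

lemma qform_zero_imp_zero:
  assumes M: "M \<in> carrier_mat n n" and q: "\<And>x. sqnorm n x \<noteq> 0 \<Longrightarrow> qform n M x = 0"
  shows "M = 0\<^sub>m n n"
proof -
  have supp: "qform n M x = (\<Sum>i\<in>S. \<Sum>j\<in>S. cnj (x i) * M $$ (i, j) * x j)"
    "sqnorm n x = (\<Sum>k\<in>S. cnj (x k) * x k)"
    if "S \<subseteq> {..<n}" "\<And>k. k \<notin> S \<Longrightarrow> x k = 0" for x S
  proof -
    have "qform n M x = (\<Sum>i<n. \<Sum>j\<in>S. cnj (x i) * M $$ (i, j) * x j)"
      unfolding qform_def using that by (intro sum.cong refl sum.mono_neutral_right) auto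
    also have "\<dots> = (\<Sum>i\<in>S. \<Sum>j\<in>S. cnj (x i) * M $$ (i, j) * x j)"
      using that by (intro sum.mono_neutral_right) auto
    finally show "qform n M x = (\<Sum>i\<in>S. \<Sum>j\<in>S. cnj (x i) * M $$ (i, j) * x j)" .
    show "sqnorm n x = (\<Sum>k\<in>S. cnj (x k) * x k)"
      unfolding sqnorm_def using that by (intro sum.mono_neutral_right) auto
  qed
  have diag: "M $$ (p, p) = 0" if p: "p < n" for p
  proof -
    let ?x = "\<lambda>k. if k = p then 1 else 0 :: complex"
    have "sqnorm n ?x = 1" "qform n M ?x = M $$ (p, p)"
      using supp[of "{p}" ?x] p by auto
    then show ?thesis using q[of ?x] by simp
  qed
  have pq: "cnj u * u = 1 \<Longrightarrow> u * M $$ (p, r) + cnj u * M $$ (r, p) = 0"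
    if p: "p < n" "r < n" "p \<noteq> r" for p r u
  proof -
    assume u: "cnj u * u = 1"
    let ?x = "\<lambda>k. if k = p then 1 else if k = r then u else 0 :: complex"
    have "sqnorm n ?x = 2" "qform n M ?x = u * M $$ (p, r) + cnj u * M $$ (r, p)"
      using supp[of "{p, r}" ?x] p u diag by (auto simp: mult_ac)
    then show ?thesis using q[of ?x] by simp
  qed
  have "M $$ (p, r) = 0" if "p < n" "r < n" for p r
  proof (cases "p = r")
    case False
    have "M $$ (p, r) + M $$ (r, p) = 0" "\<i> * (M $$ (p, r) - M $$ (r, p)) = 0"
      using pq[OF that False, of 1] pq[OF that False, of \<i>] by (auto simp: algebra_simps)
    then have "2 * M $$ (p, r) = 0" by simp
    then show ?thesis by simp
  qed (use diag that in simp)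
  then show ?thesis using M by (intro eq_matI) auto
qed

text \<open>The reflections along a vector \<open>x\<close> trace a curve in \<open>P\<close>
  through the corner. Its two first-order coefficients must agree, so the form of the commutator
  vanishes at every non-zero \<open>x\<close>.\<close>

lemma corner_imp_commute:
  assumes C: "C \<in> carrier_mat n n" and A: "A \<in> carrier_mat n n"
    and P: "polytope P" and v: "mat_trace (C * A) extreme_point_of P"
    and sub: "\<And>U. U \<in> unitary_mats n \<Longrightarrow> mat_trace (C * conj_mat U A) \<in> P"
  shows "C * A = A * C"
proof -
  have "qform n (C * A - A * C) x = 0" if x: "sqnorm n x \<noteq> 0" for x
  proof -
    define N where "N = (\<Sum>k<n. (cmod (x k))\<^sup>2)"
    have N: "sqnorm n x = of_real N"
      unfolding sqnorm_def N_def of_real_sum complex_norm_square by (simp add: mult.commute)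
    have "N \<ge> 0" unfolding N_def by (intro sum_nonneg) auto
    then have N0: "N > 0" using x unfolding N by simp
    have "qform n (C * A) x = qform n (A * C) x"
    proof (rule corner_imp_eq[OF P v N0])
      fix w assume w: "cmod w = 1"
      show "mat_trace (C * A) + (w - 1) / of_real N * qform n (C * A) x
          + cnj ((w - 1) / of_real N) * qform n (A * C) x
          + (w - 1) / of_real N * cnj ((w - 1) / of_real N) * (qform n A x * qform n C x) \<in> P"
        using sub[OF rank_one_unitary[OF w x]] unfolding trace_rank_one[OF C A] N .
    qed
    moreover have "qform n (C * A - A * C) x = qform n (C * A) x - qform n (A * C) x"
      using C A unfolding qform_def sum_subtractf[symmetric]
      by (intro sum.cong refl) (simp add: algebra_simps del: index_mult_mat(1))
    ultimately show ?thesis by simp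
  qed
  then have "C * A - A * C = 0\<^sub>m n n"
    using C A by (intro qform_zero_imp_zero) (auto simp: mult_carrier_mat[of _ n n _ n])
  moreover have "(C * A) $$ (i, j) = (A * C) $$ (i, j)" if "C * A - A * C = 0\<^sub>m n n" "i < n" "j < n" for i j
    using arg_cong[OF that(1), of "\<lambda>X. X $$ (i, j)"] that(2,3) C A
    by (simp del: index_mult_mat(1))
  ultimately show ?thesis using C A by (intro eq_matI) (auto simp del: index_mult_mat(1))
qed

section \<open>Commuting matrices\<close>

lemma eigenvalue_list_similar:
  assumes "eigenvalue_list B es" "similar_mat A B"
  shows "eigenvalue_list A es"
  using assms char_poly_similar[OF assms(2)] by (simp add: eigenvalue_list_def)

lemma similar_conj_mat:
  assumes U: "U \<in> unitary_mats n" and A: "A \<in> carrier_mat n n"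
  shows "similar_mat (conj_mat U A) A"
proof -
  have "similar_mat_wit (conj_mat U A) A (mat_adjoint U) U"
    using unitary_matsD[OF U] U A
    by (intro similar_mat_witI[of _ _ n] conj_mat_carrier mat_adjoint_carrier) (simp_all add: conj_mat_def)
  then show ?thesis unfolding similar_mat_def by blast
qed

text \<open>Starting from an eigenvector of \<open>C\<close>, the factors \<open>B - B\<^bsub>n-1,n-1\<^esub>\<close>, \<open>B - B\<^bsub>n-2,n-2\<^esub>\<close>, \<dots> are applied in turn.
  Each step stays in the eigenspace of \<open>C\<close> and kills one more trailing coordinate; the last nonzero
  vector is a common eigenvector.\<close>

lemma common_eigenvector_triangular:
  fixes B C :: "complex mat"
  assumes B: "B \<in> carrier_mat n n" and C: "C \<in> carrier_mat n n" and n: "n > 0"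
    and ut: "upper_triangular B" and comm: "C * B = B * C"
  shows "\<exists>v c b. v \<in> carrier_vec n \<and> v \<noteq> 0\<^sub>v n \<and> C *\<^sub>v v = c \<cdot>\<^sub>v v \<and> B *\<^sub>v v = b \<cdot>\<^sub>v v"
proof -
  obtain es where es: "char_poly C = (\<Prod>a\<leftarrow>es. [:- a, 1:])" "length es = n"
    using char_poly_factorized[OF C] by blast
  then obtain c where "poly (char_poly C) c = 0" using n by (cases es) auto
  then have "eigenvalue C c" by (simp add: eigenvalue_root_char_poly[OF C])
  then obtain x where x: "x \<in> carrier_vec n" "x \<noteq> 0\<^sub>v n" "C *\<^sub>v x = c \<cdot>\<^sub>v x"
    using C by (auto simp: eigenvalue_def eigenvector_def)
  \<comment> \<open>The diagonal of \<open>B\<close> read from its last entry backwards, starting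
    with \<open>k = 0\<close>.\<close>
  define \<mu> where "\<mu> k = B $$ (n - Suc k, n - Suc k)" for k
  define y where "y = rec_nat x (\<lambda>k v. B *\<^sub>v v - \<mu> k \<cdot>\<^sub>v v)"
  have y0: "y 0 = x" and yS: "y (Suc k) = B *\<^sub>v y k - \<mu> k \<cdot>\<^sub>v y k" for k by (simp_all add: y_def)
  have yc: "y k \<in> carrier_vec n" for k
    by (induction k) (use x B in \<open>auto simp: y0 yS\<close>)
  have Cy: "C *\<^sub>v y k = c \<cdot>\<^sub>v y k" for k
  proof (induction k)
    case (Suc k)
    have By: "B *\<^sub>v y k \<in> carrier_vec n" using B yc by auto
    have "C *\<^sub>v (B *\<^sub>v y k) = B *\<^sub>v (C *\<^sub>v y k)"
      using B C yc[of k] comm by (metis assoc_mult_mat_vec)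
    also have "\<dots> = c \<cdot>\<^sub>v (B *\<^sub>v y k)" unfolding Suc using B yc by (intro mult_mat_vec) auto
    finally have CB: "C *\<^sub>v (B *\<^sub>v y k) = c \<cdot>\<^sub>v (B *\<^sub>v y k)" .
    have "C *\<^sub>v y (Suc k) = C *\<^sub>v (B *\<^sub>v y k) - C *\<^sub>v (\<mu> k \<cdot>\<^sub>v y k)"
      unfolding yS using C By yc by (intro mult_minus_distrib_mat_vec) auto
    also have "C *\<^sub>v (\<mu> k \<cdot>\<^sub>v y k) = \<mu> k \<cdot>\<^sub>v (c \<cdot>\<^sub>v y k)"
      using mult_mat_vec[OF C yc] Suc by simp
    finally show ?case unfolding CB yS
      using By yc[of k] B by (intro eq_vecI) (auto simp: algebra_simps)
  qed (simp add: y0 x)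
  have vanish: "y k $ i = 0" if "k \<le> n" "n - k \<le> i" "i < n" for k i
    using that
  proof (induction k arbitrary: i)
    case (Suc k)
    have "y (Suc k) $ i = (\<Sum>j<n. B $$ (i, j) * y k $ j) - \<mu> k * y k $ i"
      unfolding yS using Suc.prems B yc[of k] by (simp add: scalar_prod_def atLeast0LessThan)
    \<comment> \<open>Terms with \<open>j < i\<close> vanish because \<open>B\<close> is triangular,
      and terms with \<open>j > i\<close> because the last \<open>k\<close> coordinates of
      \<open>y k\<close> are already zero.\<close>
    also have "(\<Sum>j<n. B $$ (i, j) * y k $ j) = (\<Sum>j<n. if j = i then B $$ (i, i) * y k $ i else 0)"
    proof (intro sum.cong refl)
      fix j assume j: "j \<in> {..<n}"
      show "B $$ (i, j) * y k $ j = (if j = i then B $$ (i, i) * y k $ i else 0)"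
      proof (cases "j < i")
        case True
        then show ?thesis using upper_triangularD[OF ut True] Suc.prems B by auto
      next
        case False
        show ?thesis
        proof (cases "j = i")
          case False
          then have "n - k \<le> j" using \<open>\<not> j < i\<close> Suc.prems by simp
          then show ?thesis using False Suc j by simp
        qed simp
      qed
    qed
    also have "\<dots> - \<mu> k * y k $ i = (B $$ (i, i) - \<mu> k) * y k $ i"
      using Suc.prems by (simp add: algebra_simps)
    also have "\<dots> = 0"
    proof (cases "n - k \<le> i")
      case True
      then show ?thesis using Suc by simp
    next
      case False
      then have "i = n - Suc k" using Suc.prems by simp
      then show ?thesis by (simp add: \<mu>_def)
    qed
    finally show ?case .
  qed simp
  have "y n = 0\<^sub>v n" using vanish[of n] yc[of n] by (intro eq_vecI) auto
  then have "\<exists>k. y k = 0\<^sub>v n" by blast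
  then obtain k where k: "y k = 0\<^sub>v n" "\<And>j. j < k \<Longrightarrow> y j \<noteq> 0\<^sub>v n"
    using exists_least_iff[of "\<lambda>k. y k = 0\<^sub>v n"] by blast
  \<comment> \<open>The least index with a zero vector is positive since \<open>y 0 = x\<close> is
    non-zero; its predecessor \<open>m\<close> yields the common eigenvector.\<close>
  then obtain m where m: "k = Suc m" using x y0 by (cases k) auto
  have "B *\<^sub>v y m = \<mu> m \<cdot>\<^sub>v y m"
  proof (rule eq_vecI)
    fix i assume "i < dim_vec (\<mu> m \<cdot>\<^sub>v y m)"
    then have "i < n" using yc[of m] by simp
    then show "(B *\<^sub>v y m) $ i = (\<mu> m \<cdot>\<^sub>v y m) $ i"
      using arg_cong[OF k(1)[unfolded m yS], of "\<lambda>v. v $ i"] B yc[of m] by simp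
  qed (use B yc[of m] in auto)
  then show ?thesis using yc[of m] Cy[of m] k(2)[of m] m by blast
qed

text \<open>A Schur decomposition makes \<open>A\<close> triangular. The same change of basis
  applied to \<open>C\<close> preserves commutation, and \<open>P\<close> carries the common
  eigenvector found there back.\<close>

lemma commuting_common_eigenvector:
  fixes A C :: "complex mat"
  assumes A: "A \<in> carrier_mat n n" and C: "C \<in> carrier_mat n n" and n: "n > 0"
    and comm: "C * A = A * C"
  obtains v c a where "v \<in> carrier_vec n" "v \<noteq> 0\<^sub>v n" "C *\<^sub>v v = c \<cdot>\<^sub>v v" "A *\<^sub>v v = a \<cdot>\<^sub>v v"
proof -
  obtain es where es: "char_poly A = (\<Prod>a\<leftarrow>es. [:- a, 1:])"
    using char_poly_factorized[OF A] by blast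
  obtain B P Q where "schur_decomposition A es = (B, P, Q)" by (cases "schur_decomposition A es")
  from schur_decomposition[OF A es this]
  have w: "similar_mat_wit A B P Q" and ut: "upper_triangular B" by auto
  note D = similar_mat_witD2[OF A w]
  note a = assoc_mult_mat[of _ n n _ n _ n] mult_carrier_mat[of _ n n _ n]
  have QPX: "Q * (P * X) = X" "P * (Q * X) = X" if "X \<in> carrier_mat n n" for X
    using D(1,2,6,7) that by (simp_all add: assoc_mult_mat[of _ n n _ n _ n, symmetric] left_mult_one_mat[of _ n n])
  define E where "E = Q * C * P"
  have E: "E \<in> carrier_mat n n" using D C by (simp add: E_def a)
  have "E * B = Q * ((C * A) * P)"
    unfolding E_def D(3) using D(1,2,5-7) C by (simp add: a QPX right_mult_one_mat[of _ n n])
  also have "\<dots> = Q * ((A * C) * P)" unfolding comm ..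
  also have "\<dots> = B * E"
    unfolding E_def D(3) using D(1,2,5-7) C by (simp add: a QPX)
  finally obtain v c b where v: "v \<in> carrier_vec n" "v \<noteq> 0\<^sub>v n" "E *\<^sub>v v = c \<cdot>\<^sub>v v" "B *\<^sub>v v = b \<cdot>\<^sub>v v"
    using common_eigenvector_triangular[OF D(5) E n ut] by blast
  have PQv: "Q *\<^sub>v (P *\<^sub>v u) = u" "P *\<^sub>v (Q *\<^sub>v u) = u" if "u \<in> carrier_vec n" for u
    using assoc_mult_mat_vec[OF D(7,6) that] assoc_mult_mat_vec[OF D(6,7) that] D(1,2) that by simp_all
  have CPE: "C = P * E * Q" unfolding E_def using D(1,2,6,7) C by (simp add: a QPX right_mult_one_mat[of _ n n])
  have tr: "(P * M * Q) *\<^sub>v (P *\<^sub>v v) = e \<cdot>\<^sub>v (P *\<^sub>v v)"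
    if "M \<in> carrier_mat n n" "M *\<^sub>v v = e \<cdot>\<^sub>v v" for M e
  proof -
    have Pv: "P *\<^sub>v v \<in> carrier_vec n" using D(6) v by auto
    have "(P * M * Q) *\<^sub>v (P *\<^sub>v v) = (P * M) *\<^sub>v (Q *\<^sub>v (P *\<^sub>v v))"
      using D(6,7) that(1) Pv by (intro assoc_mult_mat_vec[of _ n n _ n]) (auto simp: a)
    also have "\<dots> = P *\<^sub>v (M *\<^sub>v v)" unfolding PQv(1)[OF v(1)] using D(6) that(1) v(1) by (intro assoc_mult_mat_vec[of _ n n _ n]) auto
    also have "\<dots> = e \<cdot>\<^sub>v (P *\<^sub>v v)" unfolding that(2) using D(6) v(1) by (intro mult_mat_vec) auto
    finally show ?thesis .
  qed
  show ?thesis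
  proof
    show "P *\<^sub>v v \<in> carrier_vec n" using D(6) v by auto
    show "P *\<^sub>v v \<noteq> 0\<^sub>v n"
    proof
      assume "P *\<^sub>v v = 0\<^sub>v n"
      then have "v = Q *\<^sub>v 0\<^sub>v n" using PQv(1)[OF v(1)] by simp
      also have "\<dots> = 0\<^sub>v n" using D(7) by (intro eq_vecI) auto
      finally show False using v(2) by blast
    qed
    show "C *\<^sub>v (P *\<^sub>v v) = c \<cdot>\<^sub>v (P *\<^sub>v v)" using tr[OF E v(3)] CPE by simp
    show "A *\<^sub>v (P *\<^sub>v v) = b \<cdot>\<^sub>v (P *\<^sub>v v)" using tr[OF D(5) v(4)] D(3) by simp
  qed
qed

text \<open>Gram-Schmidt applied to a basis that starts with \<open>v\<close> keeps \<open>v\<close>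
  as the first column of \<open>W\<close>. The basis depends on \<open>v\<close> alone, so it serves
  two matrices with a common eigenvector at once.\<close>

lemma eigenvector_basis:
  fixes v :: "complex vec"
  assumes v: "v \<in> carrier_vec n" "v \<noteq> 0\<^sub>v n" and n: "n > 0"
  obtains W W' where "W \<in> carrier_mat n n" "W' \<in> carrier_mat n n" "W' * W = 1\<^sub>m n" "W * W' = 1\<^sub>m n"
    "\<And>A e. A \<in> carrier_mat n n \<Longrightarrow> A *\<^sub>v v = e \<cdot>\<^sub>v v \<Longrightarrow>
      col (W' * A * W) 0 = vec n (\<lambda>i. if i = 0 then e else 0)"
proof -
  interpret cof_vec_space n "TYPE(complex)" .
  define b where "b = basis_completion v"
  define ws where "ws = gram_schmidt n b"
  from basis_completion[OF v, folded b_def]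
  have dist_b: "distinct b" and indep: "\<not> lin_dep (set b)" and b: "set b \<subseteq> carrier_vec n"
    and hdb: "hd b = v" and len_b: "length b = n" by auto
  from hdb len_b n obtain vs where bv: "b = v # vs" by (cases b) auto
  from gram_schmidt_result[OF b dist_b indep refl, folded ws_def]
  have ws: "set ws \<subseteq> carrier_vec n" "corthogonal ws" "length ws = n" by (auto simp: len_b)
  from gram_schmidt_hd[OF v(1), of vs, folded bv] have hdws: "hd ws = v" unfolding ws_def .
  define W where "W = mat_of_cols n ws"
  define W' where "W' = corthogonal_inv W"
  have W: "W \<in> carrier_mat n n" using ws mat_of_cols_carrier(1)[of n ws] unfolding W_def by auto
  have W': "W' \<in> carrier_mat n n"
    unfolding W'_def corthogonal_inv_def using W by (auto simp: mat_of_rows_def)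
  have "corthogonal_mat W" using orthogonal_mat_of_cols ws unfolding W_def by blast
  from corthogonal_inv_result[OF this] have W'W: "W' * W = 1\<^sub>m n"
    using W W' unfolding W'_def[symmetric] inverts_mat_def by auto
  show ?thesis
  proof (rule that[OF W W' W'W mat_mult_left_right_inverse[OF W' W W'W]])
    fix A :: "complex mat" and e assume "A \<in> carrier_mat n n" "A *\<^sub>v v = e \<cdot>\<^sub>v v"
    then show "col (W' * A * W) 0 = vec n (\<lambda>i. if i = 0 then e else 0)"
      unfolding W'_def W_def using corthogonal_col_ev_0[OF _ v(1) v(2) _ _ hdws ws] n by auto
  qed
qed

text \<open>The vanishing first column below the corner makes \<open>A\<close> block triangular, so
  its characteristic polynomial factors.\<close>

lemma eigenvalue_list_deflate:
  fixes A :: "complex mat"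
  assumes A: "A \<in> carrier_mat (Suc m) (Suc m)"
    and col0: "\<And>i. i < m \<Longrightarrow> A $$ (Suc i, 0) = 0"
    and es: "eigenvalue_list (Matrix.mat m m (\<lambda>(i, j). A $$ (Suc i, Suc j))) es"
  shows "eigenvalue_list A (A $$ (0, 0) # es)"
proof -
  let ?A3 = "Matrix.mat m m (\<lambda>(i, j). A $$ (Suc i, Suc j))"
  let ?A1 = "Matrix.mat 1 1 (\<lambda>_. A $$ (0, 0))"
  let ?A2 = "Matrix.mat 1 m (\<lambda>(i, j). A $$ (0, Suc j))"
  have "A = four_block_mat ?A1 ?A2 (0\<^sub>m m 1) ?A3"
  proof (rule eq_matI)
    fix i j assume "i < dim_row (four_block_mat ?A1 ?A2 (0\<^sub>m m 1) ?A3)"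
      "j < dim_col (four_block_mat ?A1 ?A2 (0\<^sub>m m 1) ?A3)"
    then show "A $$ (i, j) = four_block_mat ?A1 ?A2 (0\<^sub>m m 1) ?A3 $$ (i, j)"
      by (cases i; cases j) (auto simp: col0)
  qed (use A in auto)
  then have "char_poly A = char_poly ?A1 * char_poly ?A3"
    using char_poly_four_block_zeros_col[of ?A1 ?A2 m ?A3] by simp
  moreover have "char_poly ?A1 = [:- A $$ (0, 0), 1:]"
    by (simp add: char_poly_defs det_def sign_def)
  ultimately show ?thesis using es by (simp add: eigenvalue_list_def)
qed

text \<open>Induction by deflation: a common eigenvector becomes the first basis vector, and the
  lower right blocks commute again. Both eigenvalue lists are built along the same basis, which
  pairs their entries correctly.\<close>

lemma commuting_trace_eigenvalues:
  fixes A C :: "complex mat"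
  assumes "A \<in> carrier_mat n n" "C \<in> carrier_mat n n" "C * A = A * C"
  shows "\<exists>cs as. eigenvalue_list C cs \<and> eigenvalue_list A as \<and>
    mat_trace (C * A) = (\<Sum>i<n. cs ! i * as ! i)"
  using assms
proof (induction n arbitrary: A C)
  case 0
  obtain cs as where "eigenvalue_list C cs" "eigenvalue_list A as"
    using char_poly_factorized[OF 0(1)] char_poly_factorized[OF 0(2)] unfolding eigenvalue_list_def by blast
  moreover have "mat_trace (C * A) = 0" using 0 by (simp add: mat_trace_def)
  ultimately show ?case by auto
next
  case (Suc m)
  let ?n = "Suc m"
  note A = Suc.prems(1) and C = Suc.prems(2) and comm = Suc.prems(3)
  obtain v c a where v: "v \<in> carrier_vec ?n" "v \<noteq> 0\<^sub>v ?n" "C *\<^sub>v v = c \<cdot>\<^sub>v v" "A *\<^sub>v v = a \<cdot>\<^sub>v v"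
    using commuting_common_eigenvector[OF A C _ comm] by blast
  obtain W W' where W: "W \<in> carrier_mat ?n ?n" "W' \<in> carrier_mat ?n ?n" "W' * W = 1\<^sub>m ?n" "W * W' = 1\<^sub>m ?n"
    and col0: "\<And>A e. A \<in> carrier_mat ?n ?n \<Longrightarrow> A *\<^sub>v v = e \<cdot>\<^sub>v v \<Longrightarrow>
      col (W' * A * W) 0 = vec ?n (\<lambda>i. if i = 0 then e else 0)"
    using eigenvector_basis[OF v(1,2)] by blast
  note as = assoc_mult_mat[of _ ?n ?n _ ?n _ ?n] mult_carrier_mat[of _ ?n ?n _ ?n]
  have WX: "W * (W' * X) = X" if "X \<in> carrier_mat ?n ?n" for X
    using W that by (simp add: assoc_mult_mat[of _ ?n ?n _ ?n _ ?n, symmetric] left_mult_one_mat[of _ ?n ?n])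
  define A' C' where "A' = W' * A * W" and "C' = W' * C * W"
  have A': "A' \<in> carrier_mat ?n ?n" and C': "C' \<in> carrier_mat ?n ?n"
    using W A C by (auto simp: A'_def C'_def as)
  have "similar_mat X (W' * X * W)" if X: "X \<in> carrier_mat ?n ?n" for X
  proof -
    have "similar_mat_wit X (W' * X * W) W W'"
      using W X by (intro similar_mat_witI[of _ _ ?n]) (simp_all add: as WX right_mult_one_mat[of _ ?n ?n])
    then show ?thesis unfolding similar_mat_def by blast
  qed
  then have sim: "similar_mat A A'" "similar_mat C C'"
    using A C unfolding A'_def C'_def by blast+
  have prod: "C' * A' = W' * (C * A) * W" "A' * C' = W' * (A * C) * W"
    using W A C by (simp_all add: A'_def C'_def as WX)
  then have comm': "C' * A' = A' * C'" using comm by simp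
  have "mat_trace (C' * A') = mat_trace (W * (W' * (C * A)))"
    unfolding prod using W A C by (intro mat_trace_comm[of _ ?n ?n]) (auto simp: as)
  then have tr: "mat_trace (C * A) = mat_trace (C' * A')" using A C by (simp add: WX as)
  have zA: "A' $$ (Suc i, 0) = 0" and zC: "C' $$ (Suc i, 0) = 0" if "i < m" for i
    using that arg_cong[OF col0[OF A v(4)], of "\<lambda>v. v $ Suc i"] arg_cong[OF col0[OF C v(3)], of "\<lambda>v. v $ Suc i"]
      A' C' unfolding A'_def[symmetric] C'_def[symmetric] by auto
  define A3 C3 where "A3 = Matrix.mat m m (\<lambda>(i, j). A' $$ (Suc i, Suc j))"
    and "C3 = Matrix.mat m m (\<lambda>(i, j). C' $$ (Suc i, Suc j))"
  have A3: "A3 \<in> carrier_mat m m" and C3: "C3 \<in> carrier_mat m m" by (auto simp: A3_def C3_def)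
  have "C3 * A3 = A3 * C3"
  proof (rule eq_matI)
    fix i j assume "i < dim_row (A3 * C3)" "j < dim_col (A3 * C3)"
    then have ij: "i < m" "j < m" using A3 C3 by auto
    \<comment> \<open>The term with index 0 drops out because of the zero in the first column, so
      products of the blocks are blocks of the products.\<close>
    have prod_index: "(X * Y) $$ (Suc i, Suc j) = (\<Sum>l<m. X $$ (Suc i, Suc l) * Y $$ (Suc l, Suc j))"
      if "X \<in> carrier_mat ?n ?n" "Y \<in> carrier_mat ?n ?n" "X $$ (Suc i, 0) = 0" for X Y :: "complex mat"
      using ij that by (subst index_mult_mat_sum[OF that(1,2)]) (auto simp: sum.lessThan_Suc_shift simp del: sum.lessThan_Suc)
    have "(\<Sum>l<m. C' $$ (Suc i, Suc l) * A' $$ (Suc l, Suc j))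
        = (\<Sum>l<m. A' $$ (Suc i, Suc l) * C' $$ (Suc l, Suc j))"
      unfolding prod_index[OF C' A' zC[OF ij(1)], symmetric] prod_index[OF A' C' zA[OF ij(1)], symmetric] comm' ..
    then show "(C3 * A3) $$ (i, j) = (A3 * C3) $$ (i, j)"
      using ij by (simp add: index_mult_mat_sum[OF C3 A3] index_mult_mat_sum[OF A3 C3] del: index_mult_mat(1))
        (simp add: A3_def C3_def)
  qed (use A3 C3 in auto)
  from Suc.IH[OF A3 C3 this] obtain cs as where
    l: "eigenvalue_list C3 cs" "eigenvalue_list A3 as" "mat_trace (C3 * A3) = (\<Sum>i<m. cs ! i * as ! i)" by blast
  have "eigenvalue_list C (C' $$ (0, 0) # cs)" "eigenvalue_list A (A' $$ (0, 0) # as)"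
    using eigenvalue_list_deflate[OF C' zC l(1)[unfolded C3_def]] eigenvalue_list_deflate[OF A' zA l(2)[unfolded A3_def]]
      sim by (auto intro: eigenvalue_list_similar)
  moreover have "mat_trace (C * A) = C' $$ (0, 0) * A' $$ (0, 0) + mat_trace (C3 * A3)"
  proof -
    have "mat_trace (C' * A') = (\<Sum>i<Suc m. \<Sum>j<Suc m. C' $$ (i, j) * A' $$ (j, i))"
      by (rule mat_trace_mult[OF C' A'])
    \<comment> \<open>Every mixed term contains an entry of the first column of \<open>C'\<close> or
      \<open>A'\<close> below the corner.\<close>
    also have "\<dots> = C' $$ (0, 0) * A' $$ (0, 0) + (\<Sum>i<m. \<Sum>j<m. C' $$ (Suc i, Suc j) * A' $$ (Suc j, Suc i))"
      by (simp add: sum.lessThan_Suc_shift zA zC del: sum.lessThan_Suc)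
    also have "(\<Sum>i<m. \<Sum>j<m. C' $$ (Suc i, Suc j) * A' $$ (Suc j, Suc i)) = mat_trace (C3 * A3)"
      unfolding mat_trace_mult[OF C3 A3] by (simp add: A3_def C3_def)
    finally show ?thesis unfolding tr .
  qed
  then have "mat_trace (C * A) = (\<Sum>i<?n. (C' $$ (0, 0) # cs) ! i * (A' $$ (0, 0) # as) ! i)"
    by (simp add: l(3) sum.lessThan_Suc_shift del: sum.lessThan_Suc)
  ultimately show ?case by blast
qed

section \<open>Vertices of a polygonal numerical range\<close>

lemma polygon_extreme_point_eigenvalues:
  assumes C: "C \<in> carrier_mat n n" and F: "\<F> \<subseteq> carrier_mat n n"
    and P: "polytope (C_numrange_family C \<F>)"
    and v: "v extreme_point_of C_numrange_family C \<F>"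
  shows "\<exists>A\<in>\<F>. \<exists>cs as. eigenvalue_list C cs \<and> eigenvalue_list A as \<and> v = (\<Sum>i<n. cs ! i * as ! i)"
proof -
  have "v \<in> C_numrange_family C \<F>" using v by (simp add: extreme_point_of_def)
  then obtain A where A: "A \<in> \<F>" "v \<in> C_numrange C A" by (auto simp: C_numrange_family_def)
  then have Ac: "A \<in> carrier_mat n n" using F by auto
  obtain U where U: "U \<in> unitary_mats n" "v = mat_trace (C * conj_mat U A)"
    using A(2) by (auto simp: C_numrange_iff[OF Ac C])
  let ?B = "conj_mat U A"
  have B: "?B \<in> carrier_mat n n" using U Ac by simp
  have "mat_trace (C * conj_mat V ?B) \<in> C_numrange_family C \<F>" if "V \<in> unitary_mats n" for V
  proof -
    have "mat_trace (C * conj_mat V ?B) \<in> C_numrange C A"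
      unfolding conj_mat_conj_mat[OF that U(1) Ac] C_numrange_iff[OF Ac C]
      using unitary_mult[OF U(1) that] by blast
    then show ?thesis using A(1) unfolding C_numrange_family_def by blast
  qed
  \<comment> \<open>Replacing \<open>A\<close> by its conjugate \<open>?B\<close> puts the vertex at
    the identity unitary, where the corner argument applies.\<close>
  from corner_imp_commute[OF C B P v[unfolded U(2)] this] have "C * ?B = ?B * C" by simp
  from commuting_trace_eigenvalues[OF B C this] obtain cs as where
    l: "eigenvalue_list C cs" "eigenvalue_list ?B as" "v = (\<Sum>i<n. cs ! i * as ! i)" unfolding U(2) by blast
  have "eigenvalue_list A as"
    by (rule eigenvalue_list_similar[OF l(2) similar_mat_sym[OF similar_conj_mat[OF U(1) Ac]]])
  then show ?thesis using A(1) l by blast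
qed

text \<open>A polytope is the convex hull of its extreme points, so these serve as \<open>V\<close>.
  They are finitely many because each of them belongs to any generating set.\<close>

lemma numrange_family_polygon_iff:
  assumes C: "C \<in> carrier_mat n n" and F: "\<F> \<subseteq> carrier_mat n n" "\<F> \<noteq> {}"
  shows "convex_polygon (C_numrange_family C \<F>) \<longleftrightarrow>
        (\<exists>V. finite V \<and> V \<noteq> {} \<and> C_numrange_family C \<F> = convex hull V \<and>
          (\<forall>v\<in>V. \<exists>A\<in>\<F>. \<exists>cs as. eigenvalue_list C cs \<and> eigenvalue_list A as \<and>
             v = (\<Sum>i<n. cs ! i * as ! i)))" (is "_ \<longleftrightarrow> ?r")
proof
  let ?W = "C_numrange_family C \<F>"
  assume "convex_polygon ?W"
  then have P: "polytope ?W" and ne: "?W \<noteq> {}" by (auto simp: convex_polygon_def)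
  let ?V = "{v. v extreme_point_of ?W}"
  have hull: "?W = convex hull ?V"
    using P by (intro Krein_Milman_Minkowski polytope_imp_compact polytope_imp_convex)
  obtain S where "finite S" "?W = convex hull S" using P by (auto simp: polytope_def)
  then have "finite ?V" by (auto dest: extreme_point_of_convex_hull intro: finite_subset[of _ S])
  moreover have "?V \<noteq> {}" using hull ne by (metis convex_hull_empty)
  ultimately show ?r using hull polygon_extreme_point_eigenvalues[OF C F(1) P]
    by (intro exI[of _ ?V]) blast
next
  assume ?r
  then obtain V where "finite V" "V \<noteq> {}" "C_numrange_family C \<F> = convex hull V" by blast
  then show "convex_polygon (C_numrange_family C \<F>)"
    unfolding convex_polygon_def polytope_def by (metis convex_hull_eq_empty)
qed

theorem theorem2p5:
  fixes n :: nat and C :: "complex mat" and \<F> :: "complex mat set"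
  assumes "C \<in> carrier_mat n n" and "\<not> scalar_mat C"
    and "\<F> \<subseteq> carrier_mat n n" and "\<F> \<noteq> {}"
  shows
    "(\<forall>\<mu>. C_numrange_family C \<F> = {\<mu>} \<longleftrightarrow>
        \<F> \<subseteq> {\<nu> \<cdot>\<^sub>m 1\<^sub>m n | \<nu>. \<nu> * mat_trace C = \<mu>})
     \<and> (\<forall>L. straight_line L \<longrightarrow>
        (C_numrange_family C \<F> \<subseteq> L \<longleftrightarrow>
          \<F> \<subseteq> {\<nu> \<cdot>\<^sub>m 1\<^sub>m n | \<nu>. \<nu> * mat_trace C \<in> L} \<or>
          (\<exists>\<alpha> \<gamma>. cmod \<alpha> = 1 \<and> cmod \<gamma> = 1 \<and>
             hermitian_mat (\<gamma> \<cdot>\<^sub>m trace_free_part C) \<and>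
             (\<forall>A\<in>\<F>. hermitian_mat (\<alpha> \<cdot>\<^sub>m trace_free_part A)) \<and>
             {mat_trace C * mat_trace A / of_nat n | A. A \<in> \<F>} \<subseteq> L \<and>
             affine_parallel L (span {cnj (\<alpha> * \<gamma>)}))))
     \<and> (convex_polygon (C_numrange_family C \<F>) \<longleftrightarrow>
        (\<exists>V. finite V \<and> V \<noteq> {} \<and> C_numrange_family C \<F> = convex hull V \<and>
          (\<forall>v\<in>V. \<exists>A\<in>\<F>. \<exists>cs as. eigenvalue_list C cs \<and> eigenvalue_list A as \<and>
             v = (\<Sum>i<n. cs ! i * as ! i))))"
  using numrange_family_singleton_iff[OF assms] numrange_family_line_iff[OF assms(1-3)]
    numrange_family_polygon_iff[OF assms(1,3,4)]
  by blast

end
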